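(* Let $p\in(0,\infty)$ with $p\neq2$, let $\mathfrak N$ be a finite factor, and let $U\in\mathscr U(\mathfrak N)$. Then $\|I-U\|_p^p+\|I+U\|_p^p=2^p$ if and only if $U=U^*$.
   Context: A finite factor is a von Neumann algebra factor admitting a (unique, faithful, normal) tracial state $\tau$, i.e. $M_n(\mathbb C)$ or a $\mathrm{II}_1$ factor. $\mathscr U(\mathfrak N)$ is the unitary group of $\mathfrak N$ and $\|A\|_p:=\tau(|A|^p)^{1/p}$ for $A\in\mathfrak N$. *)

theory Defs
  imports
    "HOL-Analysis.Analysis"
    "HOL-Computational_Algebra.Polynomial"
    "HOL-Library.Nonpos_Ints"
begin

text \<open>
  Complex Hilbert spaces. The real Banach space structure comes from the library class; the
  complex scalars extend the real ones, and the inner product is conjugate-linear in its first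
  argument and induces the given norm. The underlying space is neither assumed separable nor
  infinite-dimensional.
\<close>

class complex_hilbert_space = banach +
  fixes scaleC :: "complex \<Rightarrow> 'a \<Rightarrow> 'a" (infixr \<open>*\<^sub>C\<close> 75)
    and cinner :: "'a \<Rightarrow> 'a \<Rightarrow> complex"
  assumes scaleC_add_right: "c *\<^sub>C (x + y) = c *\<^sub>C x + c *\<^sub>C y"
    and scaleC_add_left: "(c + d) *\<^sub>C x = c *\<^sub>C x + d *\<^sub>C x"
    and scaleC_scaleC: "c *\<^sub>C d *\<^sub>C x = (c * d) *\<^sub>C x"
    and scaleR_eq_scaleC: "r *\<^sub>R x = complex_of_real r *\<^sub>C x"
    and cinner_commute: "cinner x y = cnj (cinner y x)"
    and cinner_add_right: "cinner x (y + z) = cinner x y + cinner x z"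
    and cinner_scaleC_right: "cinner x (c *\<^sub>C y) = c * cinner x y"
    and cinner_self: "cinner x x = complex_of_real ((norm x)\<^sup>2)"
begin

lemma norm_scaleC: "norm (c *\<^sub>C x) = cmod c * norm x"
proof -
  have "cinner (c *\<^sub>C x) x = cnj c * cinner x x"
    by (subst cinner_commute) (simp add: cinner_scaleC_right cinner_self)
  then have "cinner (c *\<^sub>C x) (c *\<^sub>C x) = (c * cnj c) * cinner x x"
    by (simp add: cinner_scaleC_right)
  then have "complex_of_real ((norm (c *\<^sub>C x))\<^sup>2) = complex_of_real ((cmod c)\<^sup>2) * complex_of_real ((norm x)\<^sup>2)"
    by (simp only: cinner_self complex_norm_square)
  then have "(norm (c *\<^sub>C x))\<^sup>2 = (cmod c)\<^sup>2 * (norm x)\<^sup>2"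
    by (simp only: of_real_mult[symmetric] of_real_eq_iff)
  then have "(norm (c *\<^sub>C x))\<^sup>2 = (cmod c * norm x)\<^sup>2"
    by (simp only: power_mult_distrib)
  then show ?thesis
    by (rule power2_eq_imp_eq) simp_all
qed

end

text \<open>
  The algebra of bounded complex-linear operators, carved out of the library's bounded real-linear
  ones.
\<close>

definition bounded_ops :: "('h::complex_hilbert_space \<Rightarrow>\<^sub>L 'h) set" where
  "bounded_ops = {T :: 'h \<Rightarrow>\<^sub>L 'h. \<forall>c x. T (c *\<^sub>C x) = c *\<^sub>C T x}"

lift_definition scalar_op :: "complex \<Rightarrow> ('h::complex_hilbert_space \<Rightarrow>\<^sub>L 'h)" is "\<lambda>c x. c *\<^sub>C x"
proof -
  fix c :: complex
  show "bounded_linear (\<lambda>x :: 'h. c *\<^sub>C x)"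
  proof (rule bounded_linear_intro)
    show "c *\<^sub>C (x + y) = c *\<^sub>C x + c *\<^sub>C y" for x y :: 'h
      by (rule scaleC_add_right)
    show "c *\<^sub>C (r *\<^sub>R x) = r *\<^sub>R (c *\<^sub>C x)" for r and x :: 'h
      by (simp only: scaleR_eq_scaleC scaleC_scaleC mult.commute)
    show "norm (c *\<^sub>C x) \<le> norm x * cmod c" for x :: 'h
      by (simp only: norm_scaleC mult.commute order_refl)
  qed
qed

definition adj :: "('h::complex_hilbert_space \<Rightarrow>\<^sub>L 'h) \<Rightarrow> ('h \<Rightarrow>\<^sub>L 'h)" where
  "adj T = (THE S :: 'h \<Rightarrow>\<^sub>L 'h. \<forall>x y. cinner (S x) y = cinner x (T y))"

definition pos_op :: "('h::complex_hilbert_space \<Rightarrow>\<^sub>L 'h) \<Rightarrow> bool" where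
  "pos_op T \<longleftrightarrow> T \<in> bounded_ops \<and> (\<forall>x. cinner x (T x) \<in> \<real>\<^sub>\<ge>\<^sub>0)"

definition op_le :: "('h::complex_hilbert_space \<Rightarrow>\<^sub>L 'h) \<Rightarrow> ('h \<Rightarrow>\<^sub>L 'h) \<Rightarrow> bool" where
  "op_le A B \<longleftrightarrow> pos_op (B - A)"

definition op_spectrum :: "('h::complex_hilbert_space \<Rightarrow>\<^sub>L 'h) \<Rightarrow> complex set" where
  "op_spectrum A = {z. \<not> (\<exists>B\<in>bounded_ops.
      B o\<^sub>L (A - scalar_op z) = id_blinfun \<and> (A - scalar_op z) o\<^sub>L B = id_blinfun)}"

definition op_poly :: "real poly \<Rightarrow> ('h::complex_hilbert_space \<Rightarrow>\<^sub>L 'h) \<Rightarrow> ('h \<Rightarrow>\<^sub>L 'h)" where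
  "op_poly P A = (\<Sum>i\<le>degree P. coeff P i *\<^sub>R (((o\<^sub>L) A ^^ i) id_blinfun))"

text \<open>
  The continuous functional calculus $f(A)$ of a self-adjoint operator, for $f$ real-valued and
  continuous on the (real) spectrum of $A$: the common norm limit of $P_n(A)$ over all sequences of
  real polynomials $P_n$ converging to $f$ uniformly on the spectrum.
\<close>

definition cfc :: "(real \<Rightarrow> real) \<Rightarrow> ('h::complex_hilbert_space \<Rightarrow>\<^sub>L 'h) \<Rightarrow> ('h \<Rightarrow>\<^sub>L 'h)" where
  "cfc f A = (THE T. \<forall>P :: nat \<Rightarrow> real poly.
      uniform_limit {t. complex_of_real t \<in> op_spectrum A} (\<lambda>n. poly (P n)) f sequentially
      \<longrightarrow> (\<lambda>n. op_poly (P n) A) \<longlonglongrightarrow> T)"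

definition op_abs :: "('h::complex_hilbert_space \<Rightarrow>\<^sub>L 'h) \<Rightarrow> ('h \<Rightarrow>\<^sub>L 'h)" where
  "op_abs A = cfc sqrt (adj A o\<^sub>L A)"

text \<open>Meant for positive \<open>A\<close> and \<open>p > 0\<close>; note \<open>0 powr p = 0\<close>.\<close>

definition op_powr :: "('h::complex_hilbert_space \<Rightarrow>\<^sub>L 'h) \<Rightarrow> real \<Rightarrow> ('h \<Rightarrow>\<^sub>L 'h)" where
  "op_powr A p = cfc (\<lambda>t. t powr p) A"

definition commutant :: "('h::complex_hilbert_space \<Rightarrow>\<^sub>L 'h) set \<Rightarrow> ('h \<Rightarrow>\<^sub>L 'h) set" where
  "commutant M = {T\<in>bounded_ops. \<forall>A\<in>M. T o\<^sub>L A = A o\<^sub>L T}"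

text \<open>
  Von Neumann algebras as the self-adjoint sets of operators equal to their bicommutant; being a
  unital subalgebra is implied.
\<close>

definition von_neumann_algebra :: "('h::complex_hilbert_space \<Rightarrow>\<^sub>L 'h) set \<Rightarrow> bool" where
  "von_neumann_algebra M \<longleftrightarrow>
     M \<subseteq> bounded_ops \<and> (\<forall>A\<in>M. adj A \<in> M) \<and> commutant (commutant M) = M"

definition factor :: "('h::complex_hilbert_space \<Rightarrow>\<^sub>L 'h) set \<Rightarrow> bool" where
  "factor M \<longleftrightarrow> von_neumann_algebra M \<and> M \<inter> commutant M = range scalar_op"

text \<open>
  Functionals on \<open>M\<close> are total functions of which only the values on \<open>M\<close> matter.
\<close>

definition tracial_state ::
    "('h::complex_hilbert_space \<Rightarrow>\<^sub>L 'h) set \<Rightarrow> (('h \<Rightarrow>\<^sub>L 'h) \<Rightarrow> complex) \<Rightarrow> bool" where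
  "tracial_state M \<tau> \<longleftrightarrow>
     (\<forall>A\<in>M. \<forall>B\<in>M. \<tau> (A + B) = \<tau> A + \<tau> B) \<and>
     (\<forall>c. \<forall>A\<in>M. \<tau> (scalar_op c o\<^sub>L A) = c * \<tau> A) \<and>
     (\<forall>A\<in>M. \<tau> (adj A o\<^sub>L A) \<in> \<real>\<^sub>\<ge>\<^sub>0) \<and>
     \<tau> id_blinfun = 1 \<and>
     (\<forall>A\<in>M. \<forall>B\<in>M. \<tau> (A o\<^sub>L B) = \<tau> (B o\<^sub>L A))"

definition faithful_on ::
    "('h::complex_hilbert_space \<Rightarrow>\<^sub>L 'h) set \<Rightarrow> (('h \<Rightarrow>\<^sub>L 'h) \<Rightarrow> complex) \<Rightarrow> bool" where
  "faithful_on M \<tau> \<longleftrightarrow> (\<forall>A\<in>M. \<tau> (adj A o\<^sub>L A) = 0 \<longrightarrow> A = 0)"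

text \<open>
  Normality: the positive functional \<open>\<tau>\<close> preserves suprema of upward directed families of
  self-adjoint elements of \<open>M\<close>.
\<close>

definition normal_on ::
    "('h::complex_hilbert_space \<Rightarrow>\<^sub>L 'h) set \<Rightarrow> (('h \<Rightarrow>\<^sub>L 'h) \<Rightarrow> complex) \<Rightarrow> bool" where
  "normal_on M \<tau> \<longleftrightarrow>
     (\<forall>D S. D \<noteq> {} \<and> D \<subseteq> {A\<in>M. adj A = A} \<and>
        (\<forall>A\<in>D. \<forall>B\<in>D. \<exists>C\<in>D. op_le A C \<and> op_le B C) \<and>
        S \<in> M \<and> adj S = S \<and> (\<forall>A\<in>D. op_le A S) \<and>
        (\<forall>R\<in>M. adj R = R \<and> (\<forall>A\<in>D. op_le A R) \<longrightarrow> op_le S R)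
        \<longrightarrow> Re (\<tau> S) = (SUP A\<in>D. Re (\<tau> A)))"

definition faithful_normal_tracial_state ::
    "('h::complex_hilbert_space \<Rightarrow>\<^sub>L 'h) set \<Rightarrow> (('h \<Rightarrow>\<^sub>L 'h) \<Rightarrow> complex) \<Rightarrow> bool" where
  "faithful_normal_tracial_state M \<tau> \<longleftrightarrow>
     tracial_state M \<tau> \<and> faithful_on M \<tau> \<and> normal_on M \<tau>"

text \<open>The trace of a finite factor is automatically unique on \<open>M\<close>.\<close>

definition finite_factor :: "('h::complex_hilbert_space \<Rightarrow>\<^sub>L 'h) set \<Rightarrow> bool" where
  "finite_factor M \<longleftrightarrow> factor M \<and> (\<exists>\<tau>. faithful_normal_tracial_state M \<tau>)"

definition unitary_group :: "('h::complex_hilbert_space \<Rightarrow>\<^sub>L 'h) set \<Rightarrow> ('h \<Rightarrow>\<^sub>L 'h) set" where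
  "unitary_group M = {U\<in>M. adj U o\<^sub>L U = id_blinfun \<and> U o\<^sub>L adj U = id_blinfun}"

text \<open>\<open>\<tau> (|A|\<^sup>p)\<close> is real and non-negative; \<open>Re\<close> only changes its type.\<close>

definition trace_norm ::
    "(('h::complex_hilbert_space \<Rightarrow>\<^sub>L 'h) \<Rightarrow> complex) \<Rightarrow> real \<Rightarrow> ('h \<Rightarrow>\<^sub>L 'h) \<Rightarrow> real" where
  "trace_norm \<tau> p A = Re (\<tau> (op_powr (op_abs A) p)) powr (1 / p)"

end

theory Submission
  imports Defs "HOL-Computational_Algebra.Fundamental_Theorem_Algebra"
begin

text \<open>
  Put \<open>B = |I - U|\<^sup>2\<close>, so that \<open>|I + U|\<^sup>2 = 4 - B\<close> and \<open>0 \<le> B \<le> 4\<close>, and let \<open>q = p / 2\<close>. The identity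
  says that \<open>g(B)\<close> has trace zero for \<open>g(t) = t powr q + (4 - t) powr q - 4 powr q\<close>. Since
  \<open>q \<noteq> 1\<close>, \<open>g\<close> has constant sign on \<open>[0, 4]\<close> and vanishes there only at the end points; by
  faithfulness the spectrum of \<open>B\<close> is then contained in \<open>{0, 4}\<close>, which amounts to
  \<open>0 = B (4 - B) = (U - U*)* (U - U*)\<close>.

  The norm identity \<open>\<parallel>P(A)\<parallel> = sup |P|\<close> over the spectrum, on which the functional calculus rests, is
  obtained for self-adjoint \<open>A\<close> and real polynomials \<open>P\<close> without the spectral radius formula: one
  of \<open>\<plusminus>\<parallel>A\<parallel>\<close> is always a spectral value.
\<close>

subsection \<open>Inner products and Riesz representation\<close>

lemma scaleC_zero_right [simp]: "c *\<^sub>C 0 = (0::'h::complex_hilbert_space)"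
  using scaleC_add_right[of c 0 "0::'h"] by simp

lemma scaleC_minus_right: "c *\<^sub>C (- x) = - (c *\<^sub>C (x::'h::complex_hilbert_space))"
  using scaleC_add_right[of c x "- x"] by (simp add: eq_neg_iff_add_eq_0 add.commute)

lemma scaleC_diff_right: "c *\<^sub>C (x - y) = c *\<^sub>C x - c *\<^sub>C (y::'h::complex_hilbert_space)"
  using scaleC_add_right[of c x "- y"] by (simp add: scaleC_minus_right)

lemma scaleC_scaleR: "c *\<^sub>C (r *\<^sub>R x) = r *\<^sub>R (c *\<^sub>C (x::'h::complex_hilbert_space))"
  by (simp add: scaleR_eq_scaleC scaleC_scaleC mult.commute)

lemma cinner_zero_right [simp]: "cinner x 0 = 0" for x :: "'h::complex_hilbert_space"
  using cinner_add_right[of x 0 0] by simp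

lemma cinner_minus_right: "cinner x (- y) = - cinner x y" for x :: "'h::complex_hilbert_space"
  using cinner_add_right[of x y "- y"] by (simp add: eq_neg_iff_add_eq_0 add.commute)

lemma cinner_diff_right: "cinner x (y - z) = cinner x y - cinner x z" for x :: "'h::complex_hilbert_space"
  using cinner_add_right[of x y "- z"] by (simp add: cinner_minus_right)

lemma cinner_scaleR_right: "cinner x (r *\<^sub>R y) = of_real r * cinner x y" for x :: "'h::complex_hilbert_space"
  by (simp add: scaleR_eq_scaleC cinner_scaleC_right)

lemma cinner_add_left: "cinner (x + y) z = cinner x z + cinner y z" for x :: "'h::complex_hilbert_space"
  by (metis cinner_commute cinner_add_right complex_cnj_add)

lemma cinner_diff_left: "cinner (x - y) z = cinner x z - cinner y z" for x :: "'h::complex_hilbert_space"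
  by (metis cinner_commute cinner_diff_right complex_cnj_diff)

lemma cinner_minus_left: "cinner (- x) z = - cinner x z" for x :: "'h::complex_hilbert_space"
  by (metis cinner_commute cinner_minus_right complex_cnj_minus)

lemma cinner_zero_left [simp]: "cinner 0 x = 0" for x :: "'h::complex_hilbert_space"
  by (metis cinner_commute cinner_zero_right complex_cnj_zero)

lemma cinner_scaleC_left: "cinner (c *\<^sub>C x) y = cnj c * cinner x y" for x :: "'h::complex_hilbert_space"
  by (metis cinner_commute cinner_scaleC_right complex_cnj_mult)

lemma cinner_scaleR_left: "cinner (r *\<^sub>R x) y = of_real r * cinner x y" for x :: "'h::complex_hilbert_space"
  by (simp add: scaleR_eq_scaleC cinner_scaleC_left)

lemmas cinner_simps = cinner_add_left cinner_add_right cinner_diff_left cinner_diff_right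
  cinner_minus_left cinner_minus_right cinner_scaleR_left cinner_scaleR_right

lemma Re_cinner_commute: "Re (cinner x y) = Re (cinner y x)" for x :: "'h::complex_hilbert_space"
  by (subst cinner_commute) simp

lemma Re_cinner_self: "Re (cinner x x) = (norm x)\<^sup>2" for x :: "'h::complex_hilbert_space"
  by (simp add: cinner_self)

lemma norm_add_sq: "(norm (x + y))\<^sup>2 = (norm x)\<^sup>2 + 2 * Re (cinner x y) + (norm y)\<^sup>2"
  for x :: "'h::complex_hilbert_space"
  using Re_cinner_commute[of x y] by (simp add: Re_cinner_self[symmetric] cinner_simps)

lemma norm_diff_sq: "(norm (x - y))\<^sup>2 = (norm x)\<^sup>2 - 2 * Re (cinner x y) + (norm y)\<^sup>2"
  for x :: "'h::complex_hilbert_space"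
  using Re_cinner_commute[of x y] by (simp add: Re_cinner_self[symmetric] cinner_simps)

lemma Re_cinner_le: "Re (cinner x y) \<le> norm x * norm y" for x :: "'h::complex_hilbert_space"
proof -
  have "(norm (x + y))\<^sup>2 \<le> (norm x + norm y)\<^sup>2"
    by (intro power_mono norm_triangle_ineq) simp
  then show ?thesis by (simp add: norm_add_sq power2_sum)
qed

lemma norm_cinner_le: "cmod (cinner x y) \<le> norm x * norm y" for x :: "'h::complex_hilbert_space"
proof (cases "cinner x y = 0")
  case False
  define c where "c = cnj (cinner x y) / cmod (cinner x y)"
  have c: "cmod c = 1" using False by (simp add: c_def norm_divide)
  have "cinner x (c *\<^sub>C y) = cmod (cinner x y)"
    using False by (simp add: c_def cinner_scaleC_right field_simps complex_norm_square[symmetric]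
        flip: power2_eq_square)
  with Re_cinner_le[of x "c *\<^sub>C y"] show ?thesis by (simp add: norm_scaleC c)
qed simp

lemma bounded_bilinear_cinner: "bounded_bilinear (cinner :: 'h::complex_hilbert_space \<Rightarrow> _)"
  by (rule bounded_bilinear.intro)
     (auto simp: cinner_simps scaleR_conv_of_real norm_cinner_le intro!: exI[of _ 1])

lemmas tendsto_cinner = bounded_bilinear.tendsto[OF bounded_bilinear_cinner]

lemma cinner_eqI: "(\<And>y. cinner x y = cinner x' y) \<Longrightarrow> x = x'" for x :: "'h::complex_hilbert_space"
proof -
  assume "\<And>y. cinner x y = cinner x' y"
  then have "cinner (x - x') (x - x') = 0" by (simp add: cinner_simps)
  then show ?thesis by (simp add: cinner_self)
qed

text \<open>The representing vector minimizes the strongly convex functional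
  \<open>x \<mapsto> \<parallel>x\<parallel>\<^sup>2 - 2 Re (f x)\<close>.\<close>

lemma riesz:
  fixes f :: "'h::complex_hilbert_space \<Rightarrow> complex"
  assumes bl: "bounded_linear f" and sc: "\<And>c x. f (c *\<^sub>C x) = c * f x"
  obtains y where "\<And>x. f x = cinner y x"
proof -
  interpret bounded_linear f by (rule bl)
  define \<phi> where "\<phi> x = (norm x)\<^sup>2 - 2 * Re (f x)" for x
  obtain K where K: "\<And>x. norm (f x) \<le> norm x * K" using bounded by blast
  have bdd: "\<phi> x \<ge> - (K\<^sup>2)" for x
  proof -
    have "Re (f x) \<le> norm x * K" using K[of x] complex_Re_le_cmod[of "f x"] by linarith
    moreover have "0 \<le> (norm x - K)\<^sup>2" by simp
    ultimately show ?thesis unfolding \<phi>_def by (simp add: power2_diff)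
  qed
  define m where "m = Inf (range \<phi>)"
  have bb: "bdd_below (range \<phi>)" by (intro bdd_belowI2[of _ "- (K\<^sup>2)"]) (use bdd in auto)
  have m: "m \<le> \<phi> x" for x unfolding m_def by (rule cInf_lower) (use bb in auto)
  have mid: "(norm (x - y))\<^sup>2 \<le> 2 * \<phi> x + 2 * \<phi> y - 4 * m" for x y
  proof -
    have "(norm (x + y))\<^sup>2 = 4 * (norm ((1/2) *\<^sub>R (x + y)))\<^sup>2"
      by (simp add: power_divide)
    moreover have "m \<le> \<phi> ((1/2) *\<^sub>R (x + y))" by (rule m)
    ultimately have "4 * m \<le> (norm (x + y))\<^sup>2 - 4 * (Re (f x) + Re (f y))"
      unfolding \<phi>_def by (simp add: scaleR add power_divide field_simps)
    then show ?thesis using norm_add_sq[of x y] norm_diff_sq[of x y] unfolding \<phi>_def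
      by (simp add: algebra_simps)
  qed
  have "\<exists>x. \<phi> x < m + inverse (Suc n)" for n
    using cInf_lessD[of "range \<phi>" "m + inverse (Suc n)"] by (auto simp: m_def)
  then obtain X where X: "\<And>n. \<phi> (X n) < m + inverse (Suc n)" by metis
  have "Cauchy X"
  proof (rule CauchyI)
    fix e :: real assume e: "e > 0"
    then obtain N where N: "inverse (of_nat (Suc N)) < e\<^sup>2 / 4"
      using reals_Archimedean[of "e\<^sup>2/4"] by auto
    have "norm (X i - X j) < e" if "i \<ge> N" "j \<ge> N" for i j
    proof -
      have "inverse (real (Suc i)) \<le> inverse (real (Suc N))" "inverse (real (Suc j)) \<le> inverse (real (Suc N))"
        using that by (auto intro!: le_imp_inverse_le)
      then have "(norm (X i - X j))\<^sup>2 < e\<^sup>2"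
        using mid[of "X i" "X j"] X[of i] X[of j] N by linarith
      then show ?thesis using e by (simp add: power2_less_imp_less)
    qed
    then show "\<exists>M. \<forall>m\<ge>M. \<forall>n\<ge>M. norm (X m - X n) < e" by blast
  qed
  then obtain y where y: "X \<longlonglongrightarrow> y" using Cauchy_convergent_iff convergent_def by blast
  have "(\<lambda>n. \<phi> (X n)) \<longlonglongrightarrow> \<phi> y" unfolding \<phi>_def
    by (intro tendsto_intros y tendsto)
  moreover have "(\<lambda>n. m + inverse (real (Suc n))) \<longlonglongrightarrow> m + 0"
    by (intro tendsto_intros LIMSEQ_inverse_real_of_nat)
  ultimately have "\<phi> y \<le> m + 0"
    using less_imp_le[OF X] by (intro LIMSEQ_le) blast+
  then have min: "\<phi> y \<le> \<phi> x" for x using m[of x] by simp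
  have re: "Re (f x) = Re (cinner y x)" for x
  proof (rule ccontr)
    define d where "d = Re (cinner y x) - Re (f x)"
    assume "\<not> ?thesis"
    then have d: "d \<noteq> 0" by (simp add: d_def)
    define k where "k = (norm x)\<^sup>2 + 1"
    have k: "k > 0" unfolding k_def by (smt (verit) zero_le_power2)
    define e where "e = - d / k"
    have "\<phi> (y + e *\<^sub>R x) = \<phi> y + 2 * e * d + e\<^sup>2 * (norm x)\<^sup>2"
      unfolding \<phi>_def d_def norm_add_sq by (simp add: add scaleR cinner_simps power_mult_distrib algebra_simps)
    with min[of "y + e *\<^sub>R x"] have "0 \<le> 2 * e * d + e\<^sup>2 * (norm x)\<^sup>2" by simp
    also have "\<dots> \<le> 2 * e * d + e\<^sup>2 * k" by (simp add: k_def algebra_simps)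
    also have "\<dots> = - (d\<^sup>2 / k)"
      using k by (simp add: e_def field_simps power2_eq_square)
    also have "\<dots> < 0" using d k by simp
    finally show False by simp
  qed
  have "f x = cinner y x" for x
  proof (rule complex_eqI)
    have "Re (f (\<i> *\<^sub>C x)) = Re (cinner y (\<i> *\<^sub>C x))" by (rule re)
    then show "Im (f x) = Im (cinner y x)" by (simp add: sc cinner_scaleC_right)
  qed (rule re)
  then show ?thesis by (rule that)
qed

subsection \<open>Bounded operators and adjoints\<close>

lemma bounded_opsD: "T \<in> bounded_ops \<Longrightarrow> T (c *\<^sub>C x) = c *\<^sub>C T x"
  by (simp add: bounded_ops_def)

lemma bounded_ops_intros:
  "id_blinfun \<in> bounded_ops" "0 \<in> bounded_ops" "scalar_op c \<in> bounded_ops"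
  "A \<in> bounded_ops \<Longrightarrow> B \<in> bounded_ops \<Longrightarrow> A + B \<in> bounded_ops"
  "A \<in> bounded_ops \<Longrightarrow> B \<in> bounded_ops \<Longrightarrow> A - B \<in> bounded_ops"
  "A \<in> bounded_ops \<Longrightarrow> - A \<in> bounded_ops"
  "A \<in> bounded_ops \<Longrightarrow> B \<in> bounded_ops \<Longrightarrow> A o\<^sub>L B \<in> bounded_ops"
  "A \<in> bounded_ops \<Longrightarrow> r *\<^sub>R A \<in> bounded_ops"
  by (auto simp: bounded_ops_def blinfun.bilinear_simps scaleC_add_right scaleC_diff_right
      scaleC_minus_right scaleC_scaleR scalar_op.rep_eq scaleC_scaleC mult.commute)

lemma cinner_adj_left:
  assumes "T \<in> bounded_ops"
  shows "cinner (adj T x) y = cinner x (T y)"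
proof -
  have ex: "\<exists>z. \<forall>y. cinner x (T y) = cinner z y" for x
  proof (rule riesz[of "\<lambda>y. cinner x (T y)"])
    show "bounded_linear (\<lambda>y. cinner x (T y))"
      by (intro bounded_linear_compose[OF bounded_bilinear.bounded_linear_right[OF bounded_bilinear_cinner]]
          blinfun.bounded_linear_right)
  qed (auto simp: bounded_opsD[OF assms] cinner_scaleC_right)
  then obtain S where S: "\<And>x y. cinner x (T y) = cinner (S x) y" by metis
  have "bounded_linear S"
  proof (rule bounded_linear_intro)
    show "S (x + y) = S x + S y" for x y by (rule cinner_eqI) (simp add: S[symmetric] cinner_simps)
    show "S (r *\<^sub>R x) = r *\<^sub>R S x" for r x by (rule cinner_eqI) (simp add: S[symmetric] cinner_simps)
    show "norm (S x) \<le> norm x * norm T" for x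
    proof -
      have "(norm (S x))\<^sup>2 = Re (cinner x (T (S x)))" by (simp add: S cinner_self)
      also have "\<dots> \<le> norm x * norm (T (S x))" by (rule Re_cinner_le)
      also have "\<dots> \<le> norm x * (norm T * norm (S x))" by (intro mult_left_mono norm_blinfun) simp
      finally show ?thesis
        by (cases "S x = 0") (simp_all add: power2_eq_square mult.assoc[symmetric])
    qed
  qed
  then have S': "\<forall>x y. cinner (Blinfun S x) y = cinner x (T y)" by (simp add: bounded_linear_Blinfun_apply S)
  have "adj T = Blinfun S" unfolding adj_def
  proof (rule the_equality)
    fix R :: "'a \<Rightarrow>\<^sub>L 'a"
    assume R: "\<forall>x y. cinner (R x) y = cinner x (T y)"
    show "R = Blinfun S"
      by (intro blinfun_eqI cinner_eqI) (use R S' in metis)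
  qed (rule S')
  then show ?thesis using S' by simp
qed

lemma cinner_adj_right: "T \<in> bounded_ops \<Longrightarrow> cinner x (adj T y) = cinner (T x) y"
  by (metis cinner_adj_left cinner_commute)

lemma adj_eqI: "T \<in> bounded_ops \<Longrightarrow> (\<And>x y. cinner (blinfun_apply S x) y = cinner x (T y)) \<Longrightarrow> adj T = S"
  by (intro blinfun_eqI cinner_eqI) (simp add: cinner_adj_left)

lemma adj_comp_eq_zero_iff:
  assumes "T \<in> bounded_ops" shows "adj T o\<^sub>L T = 0 \<longleftrightarrow> T = 0"
proof
  assume *: "adj T o\<^sub>L T = 0"
  show "T = 0"
  proof (rule blinfun_eqI)
    fix x
    have "cinner (T x) (T x) = cinner ((adj T o\<^sub>L T) x) x"
      by (simp add: cinner_adj_left[OF assms])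
    then show "T x = blinfun_apply 0 x" by (simp add: * cinner_self)
  qed
qed simp

subsection \<open>Invertibility and spectra of self-adjoint operators\<close>

definition invertible_op :: "('h::complex_hilbert_space \<Rightarrow>\<^sub>L 'h) \<Rightarrow> bool" where
  "invertible_op T \<longleftrightarrow> (\<exists>B\<in>bounded_ops. \<forall>x. B (T x) = x \<and> T (B x) = x)"

definition selfadj :: "('h::complex_hilbert_space \<Rightarrow>\<^sub>L 'h) \<Rightarrow> bool" where
  "selfadj A \<longleftrightarrow> A \<in> bounded_ops \<and> (\<forall>x y. cinner (A x) y = cinner x (A y))"

definition rspec :: "('h::complex_hilbert_space \<Rightarrow>\<^sub>L 'h) \<Rightarrow> real set" where
  "rspec A = {t. complex_of_real t \<in> op_spectrum A}"

lemma op_spectrum_iff: "z \<in> op_spectrum A \<longleftrightarrow> \<not> invertible_op (A - scalar_op z)"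
proof -
  have *: "S o\<^sub>L T = id_blinfun \<longleftrightarrow> (\<forall>x. S (T x) = x)" for S T :: "'a \<Rightarrow>\<^sub>L 'a"
    by (auto intro: blinfun_eqI dest: arg_cong[of _ _ blinfun_apply] simp: fun_eq_iff)
  show ?thesis unfolding op_spectrum_def invertible_op_def * by auto
qed

lemma scalar_op_of_real: "scalar_op (complex_of_real t) = t *\<^sub>R id_blinfun"
  by (rule blinfun_eqI) (simp add: scalar_op.rep_eq scaleR_eq_scaleC blinfun.bilinear_simps)

lemma rspec_iff: "t \<in> rspec A \<longleftrightarrow> \<not> invertible_op (A - t *\<^sub>R id_blinfun)"
  by (simp add: rspec_def op_spectrum_iff scalar_op_of_real)

lemma invertible_op_comp:
  assumes "invertible_op S" "invertible_op T" shows "invertible_op (S o\<^sub>L T)"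
proof -
  obtain B C where B: "B \<in> bounded_ops" "\<And>x. B (S x) = x" "\<And>x. S (B x) = x"
    and C: "C \<in> bounded_ops" "\<And>x. C (T x) = x" "\<And>x. T (C x) = x"
    using assms unfolding invertible_op_def by metis
  show ?thesis unfolding invertible_op_def
    by (rule bexI[of _ "C o\<^sub>L B"]) (simp_all add: B C bounded_ops_intros)
qed

lemma invertible_op_commD:
  assumes inv: "invertible_op (S o\<^sub>L T)" and S: "S \<in> bounded_ops" and T: "T \<in> bounded_ops"
    and comm: "S o\<^sub>L T = T o\<^sub>L S"
  shows "invertible_op S" "invertible_op T"
proof -
  obtain B where B: "B \<in> bounded_ops" "\<And>x. B (S (T x)) = x" "\<And>x. S (T (B x)) = x"
    using inv unfolding invertible_op_def by auto
  have c: "S (T x) = T (S x)" for x using comm by (metis blinfun_apply_blinfun_compose)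
  have TBS: "T (B (S x)) = x" for x
  proof -
    have "T (B (S x)) = B (T (S (T (B (S x)))))" by (simp only: B(2) c[symmetric])
    then show ?thesis by (simp only: B(2,3) c[symmetric])
  qed
  show "invertible_op S" unfolding invertible_op_def
    by (rule bexI[of _ "T o\<^sub>L B"]) (simp_all add: B T TBS bounded_ops_intros)
  show "invertible_op T" unfolding invertible_op_def
    by (rule bexI[of _ "B o\<^sub>L S"]) (simp_all add: B S TBS bounded_ops_intros)
qed

text \<open>The Lax--Milgram lemma: for small \<open>s > 0\<close> the map \<open>x \<mapsto> x - s (T x - y)\<close> is a contraction.\<close>

lemma coercive_invertible:
  fixes T :: "'h::complex_hilbert_space \<Rightarrow>\<^sub>L 'h"
  assumes T: "T \<in> bounded_ops" and c: "c > 0"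
    and co: "\<And>x. c * (norm x)\<^sup>2 \<le> Re (cinner x (T x))"
  shows "invertible_op T"
proof -
  define M where "M = norm T + c"
  have M: "M > 0" "c \<le> M" "norm T \<le> M" unfolding M_def using c by (auto intro: add_nonneg_pos)
  define s where "s = c / M\<^sup>2"
  define k where "k = 1 - c\<^sup>2 / M\<^sup>2"
  have k: "0 \<le> k" "k < 1" using M c by (simp_all add: k_def power_mono)
  have contr: "norm (x - s *\<^sub>R T x) \<le> sqrt k * norm x" for x
  proof (rule power2_le_imp_le)
    have "(norm (T x))\<^sup>2 \<le> (M * norm x)\<^sup>2"
      by (intro power_mono order.trans[OF norm_blinfun] mult_right_mono M) auto
    then have "s\<^sup>2 * (norm (T x))\<^sup>2 \<le> s\<^sup>2 * (M\<^sup>2 * (norm x)\<^sup>2)"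
      by (intro mult_left_mono) (simp_all add: power_mult_distrib)
    moreover have "s * (c * (norm x)\<^sup>2) \<le> s * Re (cinner x (T x))"
      by (intro mult_left_mono co) (use c M in \<open>simp add: s_def\<close>)
    moreover have "(norm (x - s *\<^sub>R T x))\<^sup>2 = (norm x)\<^sup>2 - 2 * (s * Re (cinner x (T x))) + s\<^sup>2 * (norm (T x))\<^sup>2"
      by (simp add: norm_diff_sq cinner_simps power_mult_distrib)
    ultimately have "(norm (x - s *\<^sub>R T x))\<^sup>2 \<le> (norm x)\<^sup>2 - 2 * (s * (c * (norm x)\<^sup>2)) + s\<^sup>2 * (M\<^sup>2 * (norm x)\<^sup>2)"
      by linarith
    also have "\<dots> = (1 - 2 * (s * c) + s\<^sup>2 * M\<^sup>2) * (norm x)\<^sup>2" by (simp add: algebra_simps)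
    also have "1 - 2 * (s * c) + s\<^sup>2 * M\<^sup>2 = k"
      using M by (simp add: s_def k_def power2_eq_square)
    finally show "(norm (x - s *\<^sub>R T x))\<^sup>2 \<le> (sqrt k * norm x)\<^sup>2"
      using k by (simp add: power_mult_distrib)
  qed (use k in simp)
  have s: "s > 0" using c M by (simp add: s_def)
  have "\<exists>x. T x = y" for y
  proof -
    have "\<exists>!x. x - s *\<^sub>R (T x - y) = x"
    proof (rule banach_fix_type)
      show "\<forall>x z. dist (x - s *\<^sub>R (T x - y)) (z - s *\<^sub>R (T z - y)) \<le> sqrt k * dist x z"
      proof (intro allI)
        fix x z
        have "dist (x - s *\<^sub>R (T x - y)) (z - s *\<^sub>R (T z - y)) = norm ((x - z) - s *\<^sub>R T (x - z))"
          by (simp add: dist_norm blinfun.bilinear_simps algebra_simps)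
        with contr[of "x - z"] show "dist (x - s *\<^sub>R (T x - y)) (z - s *\<^sub>R (T z - y)) \<le> sqrt k * dist x z"
          by (simp add: dist_norm)
      qed
    qed (use k in auto)
    then obtain x where "s *\<^sub>R (T x - y) = 0" by auto
    then show ?thesis using s by auto
  qed
  then obtain B where B: "\<And>y. T (B y) = y" by metis
  have lower: "norm x \<le> norm (T x) * (1/c)" for x
  proof -
    have "c * (norm x)\<^sup>2 \<le> norm x * norm (T x)" using co[of x] Re_cinner_le[of x "T x"] by linarith
    then have "c * norm x \<le> norm (T x)"
      by (cases "x = 0") (simp_all add: power2_eq_square)
    then show ?thesis using c by (simp add: field_simps)
  qed
  have inj: "x = y" if "T x = T y" for x y
    using lower[of "x - y"] that by (simp add: blinfun.bilinear_simps)
  have BT: "B (T x) = x" for x by (rule inj) (simp add: B)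
  have "bounded_linear B"
  proof (rule bounded_linear_intro)
    show "B (x + y) = B x + B y" for x y by (rule inj) (simp add: B blinfun.bilinear_simps)
    show "B (r *\<^sub>R x) = r *\<^sub>R B x" for r x by (rule inj) (simp add: B blinfun.bilinear_simps)
    show "norm (B x) \<le> norm x * (1/c)" for x using lower[of "B x"] by (simp add: B)
  qed
  then have ap: "blinfun_apply (Blinfun B) = B" by (rule bounded_linear_Blinfun_apply)
  have "B (d *\<^sub>C x) = d *\<^sub>C B x" for d x by (rule inj) (simp add: B bounded_opsD[OF T])
  then have "Blinfun B \<in> bounded_ops" by (simp add: bounded_ops_def ap)
  then show ?thesis unfolding invertible_op_def
    by (rule bexI[rotated]) (simp add: ap B BT)
qed

lemma scalar_op_apply [simp]: "scalar_op c x = c *\<^sub>C x"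
  by (simp add: scalar_op.rep_eq)

lemma scalar_op_commute: "A \<in> bounded_ops \<Longrightarrow> scalar_op c o\<^sub>L A = A o\<^sub>L scalar_op c"
  by (rule blinfun_eqI) (simp add: bounded_opsD)

lemma coercive_multiple_invertible:
  assumes T: "T \<in> bounded_ops" and "c > 0"
    and "\<And>x. c * (norm x)\<^sup>2 \<le> Re (w * cinner x (T x))"
  shows "invertible_op T"
proof (rule invertible_op_commD(2))
  show "invertible_op (scalar_op w o\<^sub>L T)"
    by (rule coercive_invertible[of _ c])
       (use assms in \<open>auto simp: bounded_ops_intros cinner_scaleC_right\<close>)
qed (use T in \<open>auto simp: bounded_ops_intros scalar_op_commute\<close>)

lemma selfadj_bounded: "selfadj A \<Longrightarrow> A \<in> bounded_ops"
  by (simp add: selfadj_def)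

lemma selfadj_cinner: "selfadj A \<Longrightarrow> cinner (A x) y = cinner x (A y)"
  by (simp add: selfadj_def)

lemma selfadj_Im: "selfadj A \<Longrightarrow> Im (cinner x (A x)) = 0"
  by (metis selfadj_cinner cinner_commute Reals_cnj_iff complex_is_Real_iff)

lemma selfadj_nonreal_invertible:
  assumes A: "selfadj A" and z: "Im z \<noteq> 0"
  shows "invertible_op (A - scalar_op z)"
proof (rule coercive_multiple_invertible[of _ "\<bar>Im z\<bar>" "\<i> * sgn (Im z)"])
  fix x
  have "Re (\<i> * sgn (Im z) * cinner x ((A - scalar_op z) x)) = \<bar>Im z\<bar> * (norm x)\<^sup>2"
    by (simp add: blinfun.bilinear_simps cinner_simps cinner_scaleC_right cinner_self selfadj_Im[OF A]
        abs_sgn mult.commute mult.left_commute)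
  then show "\<bar>Im z\<bar> * (norm x)\<^sup>2 \<le> Re (\<i> * sgn (Im z) * cinner x ((A - scalar_op z) x))" by simp
qed (use z A in \<open>simp_all add: bounded_ops_intros selfadj_bounded\<close>)

lemma rspec_abs_le:
  assumes A: "A \<in> bounded_ops" and t: "t \<in> rspec A"
  shows "\<bar>t\<bar> \<le> norm A"
proof (rule ccontr)
  assume n: "\<not> ?thesis"
  have "invertible_op (A - t *\<^sub>R id_blinfun)"
  proof (rule coercive_multiple_invertible[of _ "\<bar>t\<bar> * (\<bar>t\<bar> - norm A)" "- of_real t"])
    show "0 < \<bar>t\<bar> * (\<bar>t\<bar> - norm A)"
      using n norm_ge_zero[of A] by (intro mult_pos_pos) linarith+
    fix x
    have "t * Re (cinner x (A x)) \<le> \<bar>t\<bar> * \<bar>Re (cinner x (A x))\<bar>" by (metis abs_le_D1 abs_mult order_refl)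
    also have "\<dots> \<le> \<bar>t\<bar> * (norm x * (norm A * norm x))"
      using abs_Re_le_cmod[of "cinner x (A x)"] norm_cinner_le[of x "A x"]
        mult_left_mono[OF norm_blinfun[of A x] norm_ge_zero[of x]]
      by (intro mult_left_mono) linarith+
    finally show "\<bar>t\<bar> * (\<bar>t\<bar> - norm A) * (norm x)\<^sup>2 \<le> Re (- of_real t * cinner x ((A - t *\<^sub>R id_blinfun) x))"
      by (simp add: blinfun.bilinear_simps cinner_simps cinner_self algebra_simps power2_eq_square
          flip: abs_mult)
  qed (use A in \<open>auto intro!: bounded_ops_intros\<close>)
  with t show False by (simp add: rspec_iff)
qed

lemma rspec_nonneg:
  assumes A: "A \<in> bounded_ops" and pos: "\<And>x. 0 \<le> Re (cinner x (A x))" and t: "t \<in> rspec A"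
  shows "0 \<le> t"
proof (rule ccontr)
  assume n: "\<not> ?thesis"
  have "invertible_op (A - t *\<^sub>R id_blinfun)"
    by (rule coercive_invertible[of _ "- t"])
       (use A n pos in \<open>auto intro!: bounded_ops_intros simp: blinfun.bilinear_simps cinner_simps cinner_self\<close>)
  with t show False by (simp add: rspec_iff)
qed

text \<open>For \<open>m = \<parallel>A\<parallel>\<close> one has \<open>\<parallel>(m\<^sup>2 - A\<^sup>2) x\<parallel>\<^sup>2 \<le> m\<^sup>2 (m\<^sup>2 \<parallel>x\<parallel>\<^sup>2 - \<parallel>A x\<parallel>\<^sup>2)\<close>, so that
  invertibility of \<open>m\<^sup>2 - A\<^sup>2\<close> would force \<open>\<parallel>A\<parallel> < m\<close>.\<close>

lemma norm_in_rspec: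
  fixes A :: "'h::complex_hilbert_space \<Rightarrow>\<^sub>L 'h"
  assumes A: "selfadj A" and nz: "(id_blinfun :: 'h \<Rightarrow>\<^sub>L 'h) \<noteq> 0"
  shows "norm A \<in> rspec A \<or> - norm A \<in> rspec A"
proof (rule ccontr)
  assume "\<not> ?thesis"
  then have "invertible_op (A - norm A *\<^sub>R id_blinfun)" "invertible_op (A - (- norm A) *\<^sub>R id_blinfun)"
    by (auto simp: rspec_iff)
  then have "invertible_op ((A - norm A *\<^sub>R id_blinfun) o\<^sub>L (A - (- norm A) *\<^sub>R id_blinfun))"
    by (rule invertible_op_comp)
  then obtain B :: "'h \<Rightarrow>\<^sub>L 'h" where B: "\<And>x. B ((A - norm A *\<^sub>R id_blinfun) ((A - (- norm A) *\<^sub>R id_blinfun) x)) = x"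
    unfolding invertible_op_def by (metis blinfun_apply_blinfun_compose)
  define m where "m = norm A"
  define b where "b = norm B + 1"
  have b: "b > 0" by (simp add: b_def add_nonneg_pos)
  have low: "(norm x)\<^sup>2 \<le> b\<^sup>2 * (m\<^sup>2 * (m\<^sup>2 * (norm x)\<^sup>2 - (norm (A x))\<^sup>2))" for x
  proof -
    define y where "y = m\<^sup>2 *\<^sub>R x - A (A x)"
    have AA: "cinner x (A (A x)) = of_real ((norm (A x))\<^sup>2)"
      by (simp add: selfadj_cinner[OF A, of x "A x", symmetric] cinner_self)
    have "B (- y) = x"
      using B[of x] by (simp add: y_def m_def blinfun.bilinear_simps power2_eq_square algebra_simps)
    then have "norm x \<le> norm B * norm y" using norm_blinfun[of B "- y"] by simp
    also have "\<dots> \<le> b * norm y" by (simp add: b_def mult_right_mono)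
    finally have "(norm x)\<^sup>2 \<le> (b * norm y)\<^sup>2" by (rule power_mono) simp
    also have "\<dots> = b\<^sup>2 * (norm y)\<^sup>2" by (simp add: power_mult_distrib)
    also have "(norm y)\<^sup>2 = m\<^sup>2 * (m\<^sup>2 * (norm x)\<^sup>2) - 2 * (m\<^sup>2 * (norm (A x))\<^sup>2) + (norm (A (A x)))\<^sup>2"
      by (simp add: y_def norm_diff_sq cinner_simps AA
          power_mult_distrib power2_eq_square[of "m\<^sup>2"] mult.assoc)
    also have "(norm (A (A x)))\<^sup>2 \<le> (m * norm (A x))\<^sup>2"
      unfolding m_def by (rule power_mono[OF norm_blinfun]) simp
    finally show ?thesis using b by (simp add: power_mult_distrib right_diff_distrib)
  qed
  obtain v :: 'h where v: "v \<noteq> 0" using nz by (metis blinfun_eqI blinfun_apply_id_blinfun zero_blinfun.rep_eq)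
  have m: "m > 0" using low[of v] v by (cases "m = 0") (auto simp: m_def)
  define d where "d = 1 / (b\<^sup>2 * m\<^sup>2)"
  have d: "d > 0" using b m by (simp add: d_def)
  have le: "(norm (A x))\<^sup>2 \<le> (m\<^sup>2 - d) * (norm x)\<^sup>2" for x
    using low[of x] b m by (simp add: d_def field_simps)
  have "0 \<le> (m\<^sup>2 - d) * (norm v)\<^sup>2" using le[of v] by (smt (verit) zero_le_power2)
  then have dm: "0 \<le> m\<^sup>2 - d" using v by (simp add: zero_le_mult_iff)
  have "norm A \<le> sqrt (m\<^sup>2 - d)"
  proof (rule norm_blinfun_bound)
    show "norm (A x) \<le> sqrt (m\<^sup>2 - d) * norm x" for x
      by (rule power2_le_imp_le) (use le[of x] dm in \<open>simp_all add: power_mult_distrib\<close>)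
  qed (use dm in simp)
  also have "\<dots> < sqrt (m\<^sup>2)" using d by (intro real_sqrt_less_mono) simp
  finally show False by (simp add: m_def)
qed

subsection \<open>Polynomials in a self-adjoint operator\<close>

interpretation blinfun_compose: bounded_bilinear "(o\<^sub>L)"
  by (rule bounded_bilinear_blinfun_compose)

lemma blinfun_eq_iff: "A = B \<longleftrightarrow> (\<forall>x. blinfun_apply A x = blinfun_apply B x)"
  by (auto intro: blinfun_eqI)

lemma compose_id_blinfun [simp]: "A o\<^sub>L id_blinfun = A"
  by (rule blinfun_eqI) simp

lemma op_poly_eq_sum:
  assumes "degree P \<le> n"
  shows "op_poly P A = (\<Sum>i\<le>n. coeff P i *\<^sub>R (((o\<^sub>L) A ^^ i) id_blinfun))"
  unfolding op_poly_def
  by (rule sum.mono_neutral_left) (use assms in \<open>auto simp: coeff_eq_0\<close>)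

lemma op_poly_0 [simp]: "op_poly 0 A = 0"
  by (simp add: op_poly_def)

lemma op_poly_pCons [simp]: "op_poly (pCons a P) A = a *\<^sub>R id_blinfun + (A o\<^sub>L op_poly P A)"
proof -
  have "op_poly (pCons a P) A
      = (\<Sum>i\<le>Suc (degree P). coeff (pCons a P) i *\<^sub>R (((o\<^sub>L) A ^^ i) id_blinfun))"
    by (rule op_poly_eq_sum) (simp add: degree_pCons_le)
  also have "\<dots> = a *\<^sub>R id_blinfun + (\<Sum>i\<le>degree P. coeff P i *\<^sub>R (A o\<^sub>L (((o\<^sub>L) A ^^ i) id_blinfun)))"
    by (simp add: sum.atMost_Suc_shift del: sum.atMost_Suc)
  also have "(\<Sum>i\<le>degree P. coeff P i *\<^sub>R (A o\<^sub>L (((o\<^sub>L) A ^^ i) id_blinfun))) = A o\<^sub>L op_poly P A"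
    by (simp add: op_poly_def blinfun_compose.sum_right blinfun_compose.scaleR_right)
  finally show ?thesis .
qed

lemma op_poly_add: "op_poly (P + Q) A = op_poly P A + op_poly Q A"
  by (simp add: op_poly_eq_sum[of _ "max (degree P) (degree Q)"] degree_add_le_max
      scaleR_add_left sum.distrib)

lemma op_poly_smult: "op_poly (smult c P) A = c *\<^sub>R op_poly P A"
  by (simp add: op_poly_eq_sum[of _ "degree P"] degree_smult_le scaleR_sum_right)

lemma op_poly_diff: "op_poly (P - Q) A = op_poly P A - op_poly Q A"
  using op_poly_add[of P "smult (-1) Q" A] op_poly_smult[of "-1" Q A] by simp

lemma op_poly_mult: "op_poly (P * Q) A = op_poly P A o\<^sub>L op_poly Q A"
proof (induction P)
  case (pCons a P)
  then show ?case
    by (intro blinfun_eqI) (simp add: op_poly_add op_poly_smult blinfun.bilinear_simps)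
qed simp

lemma op_poly_commute: "op_poly P A o\<^sub>L op_poly Q A = op_poly Q A o\<^sub>L op_poly P A"
  by (simp add: op_poly_mult[symmetric] mult.commute)

lemma commutant_empty: "commutant {} = bounded_ops"
  by (simp add: commutant_def)

lemma commutant_intros:
  shows commutant_id: "id_blinfun \<in> commutant M"
    and commutant_zero: "0 \<in> commutant M"
    and commutant_add: "A \<in> commutant M \<Longrightarrow> B \<in> commutant M \<Longrightarrow> A + B \<in> commutant M"
    and commutant_diff: "A \<in> commutant M \<Longrightarrow> B \<in> commutant M \<Longrightarrow> A - B \<in> commutant M"
    and commutant_scaleR: "A \<in> commutant M \<Longrightarrow> r *\<^sub>R A \<in> commutant M"
  by (auto simp: commutant_def bounded_ops_intros blinfun_compose.add_left blinfun_compose.add_right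
      blinfun_compose.diff_left blinfun_compose.diff_right blinfun_compose.scaleR_left
      blinfun_compose.scaleR_right intro: blinfun_eqI)

lemma commutant_comp:
  assumes "A \<in> commutant M" "B \<in> commutant M" shows "A o\<^sub>L B \<in> commutant M"
proof -
  have "(A o\<^sub>L B) o\<^sub>L T = T o\<^sub>L (A o\<^sub>L B)" if "T \<in> M" for T
  proof (rule blinfun_eqI)
    fix x
    have "A (T y) = T (A y)" "B (T y) = T (B y)" for y
      using assms that by (auto simp: commutant_def dest!: bspec blinfun_eq_iff[THEN iffD1])
    then show "((A o\<^sub>L B) o\<^sub>L T) x = (T o\<^sub>L (A o\<^sub>L B)) x" by simp
  qed
  then show ?thesis using assms by (simp add: commutant_def bounded_ops_intros)
qed

lemma commutant_closed: "closed (commutant M)"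
proof (rule closed_sequential_limits[THEN iffD2], intro allI impI, elim conjE)
  fix X :: "nat \<Rightarrow> 'a \<Rightarrow>\<^sub>L 'a" and T
  assume X: "\<forall>n. X n \<in> commutant M" and lim: "X \<longlonglongrightarrow> T"
  have ap: "(\<lambda>n. X n x) \<longlonglongrightarrow> T x" for x by (intro blinfun.tendsto lim tendsto_const)
  have "T (c *\<^sub>C x) = c *\<^sub>C T x" for c x
  proof (rule LIMSEQ_unique[OF ap])
    have "(\<lambda>n. scalar_op c (X n x)) \<longlonglongrightarrow> scalar_op c (T x)"
      by (intro blinfun.tendsto ap tendsto_const)
    then show "(\<lambda>n. X n (c *\<^sub>C x)) \<longlonglongrightarrow> c *\<^sub>C T x"
      using X by (simp add: commutant_def bounded_opsD)
  qed
  moreover have "T o\<^sub>L S = S o\<^sub>L T" if "S \<in> M" for S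
  proof (rule LIMSEQ_unique)
    show "(\<lambda>n. (X n o\<^sub>L S)) \<longlonglongrightarrow> (T o\<^sub>L S)" by (intro blinfun_compose.tendsto lim tendsto_const)
    have "(\<lambda>n. (S o\<^sub>L X n)) \<longlonglongrightarrow> (S o\<^sub>L T)" by (intro blinfun_compose.tendsto lim tendsto_const)
    then show "(\<lambda>n. (X n o\<^sub>L S)) \<longlonglongrightarrow> (S o\<^sub>L T)" using X that by (simp add: commutant_def)
  qed
  ultimately show "T \<in> commutant M" by (simp add: commutant_def bounded_ops_def)
qed

lemma op_poly_commutant: "A \<in> commutant M \<Longrightarrow> op_poly P A \<in> commutant M"
  by (induction P) (auto intro!: commutant_intros commutant_comp)

lemma op_poly_bounded: "A \<in> bounded_ops \<Longrightarrow> op_poly P A \<in> bounded_ops"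
  using op_poly_commutant[of A "{}"] by (simp add: commutant_empty)

lemma selfadj_op_poly:
  assumes A: "selfadj A" shows "selfadj (op_poly P A)"
proof (induction P)
  case (pCons a P)
  have "op_poly P A (A x) = A (op_poly P A x)" for x
    using op_poly_commute[of P A "[:0, 1:]"] by (simp add: blinfun_eq_iff)
  with pCons A show ?case
    by (auto simp: selfadj_def bounded_ops_intros blinfun.bilinear_simps cinner_simps)
qed (simp add: selfadj_def bounded_ops_intros)

lemma invertible_op_scaleR_id: "c \<noteq> 0 \<Longrightarrow> invertible_op (c *\<^sub>R (id_blinfun :: 'h::complex_hilbert_space \<Rightarrow>\<^sub>L 'h))"
  unfolding invertible_op_def
  by (rule bexI[of _ "(1/c) *\<^sub>R id_blinfun"]) (simp_all add: bounded_ops_intros blinfun.bilinear_simps)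

lemma poly_map_of_real [simp]:
  "poly (map_poly complex_of_real P) (of_real t) = of_real (poly P t)"
  by (induction P) (simp_all add: map_poly_pCons)

lemma poly_map_of_real_add:
  "poly (map_poly complex_of_real (P + Q)) z
    = poly (map_poly of_real P) z + poly (map_poly of_real Q) z"
proof -
  have "map_poly complex_of_real (P + Q) = map_poly of_real P + map_poly of_real Q"
    by (rule poly_eqI) (simp add: coeff_map_poly)
  then show ?thesis by simp
qed

lemma poly_map_of_real_mult:
  "poly (map_poly complex_of_real (P * Q)) z
    = poly (map_poly of_real P) z * poly (map_poly of_real Q) z"
  by (induction P) (simp_all add: map_poly_pCons poly_map_of_real_add map_poly_smult algebra_simps)

lemma degree_mult_less:
  fixes P q R :: "real poly"
  assumes "P = q * R" "P \<noteq> 0" "degree q > 0" shows "degree R < degree P"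
proof -
  have "q \<noteq> 0" "R \<noteq> 0" using assms by auto
  then show ?thesis using assms by (simp add: degree_mult_eq)
qed

text \<open>A real polynomial splits into linear factors and quadratics \<open>(X - z) (X - cnj z)\<close> with
  \<open>z\<close> not real, for which \<open>A - z\<close> is invertible.\<close>

lemma op_poly_invertible:
  fixes A :: "'h::complex_hilbert_space \<Rightarrow>\<^sub>L 'h"
  assumes A: "selfadj A"
  shows "P \<noteq> 0 \<Longrightarrow> (\<And>t. t \<in> rspec A \<Longrightarrow> poly P t \<noteq> 0) \<Longrightarrow> invertible_op (op_poly P A)"
proof (induction "degree P" arbitrary: P rule: less_induct)
  case less
  show ?case
  proof (cases "degree P = 0")
    case True
    then obtain c where "P = [:c:]" by (rule degree_eq_zeroE)
    with less show ?thesis by (simp add: invertible_op_scaleR_id)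
  next
    case False
    define PC where "PC = map_poly complex_of_real P"
    have "degree PC \<noteq> 0" using False by (simp add: PC_def degree_map_poly)
    then have "\<not> constant (poly PC)" by (simp add: constant_degree)
    then obtain z where z: "poly PC z = 0" using fundamental_theorem_of_algebra by blast
    have split: "invertible_op (op_poly P A)"
      if "P = q * R" "degree q > 0" "invertible_op (op_poly q A)" for q R
    proof -
      have "invertible_op (op_poly R A)"
        using that less.prems by (intro less.hyps degree_mult_less[of P q R]) auto
      with that show ?thesis by (simp add: op_poly_mult invertible_op_comp)
    qed
    show ?thesis
    proof (cases "Im z = 0")
      case True
      define t where "t = Re z"
      have "z = of_real t" using True by (simp add: t_def complex_eq_iff)
      then have "poly P t = 0" using z unfolding PC_def by simp
      then obtain R where R: "P = [:- t, 1:] * R" unfolding poly_eq_0_iff_dvd by (rule dvdE)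
      have "t \<notin> rspec A" using less.prems(2) \<open>poly P t = 0\<close> by blast
      then show ?thesis
        by (intro split[OF R]) (simp_all add: rspec_iff)
    next
      case False
      define q where "q = [:(Re z)\<^sup>2 + (Im z)\<^sup>2, - 2 * Re z, 1:]"
      define r where "r = P mod q"
      have "degree r < 2"
        using degree_mod_less[of q P] by (auto simp: q_def r_def)
      then obtain a b where r: "r = [:a, b:]"
        by (metis One_nat_def degree_eq_zeroE less_2_cases pCons_0_0 degree1_coeffs)
      have qz: "poly (map_poly complex_of_real q) z = 0"
        by (simp add: q_def map_poly_pCons complex_eq_iff power2_eq_square algebra_simps)
      have "P = q * (P div q) + r" by (simp add: r_def)
      then have "poly (map_poly complex_of_real r) z = 0"
        using z qz unfolding PC_def by (metis poly_map_of_real_add poly_map_of_real_mult mult_zero_left add_0)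
      then have "a + z * b = 0" by (simp add: r map_poly_pCons)
      then have "r = 0" using False by (auto simp: complex_eq_iff r)
      then have P: "P = q * (P div q)" by (simp add: r_def mod_0_imp_dvd)
      have "op_poly q A = (A - scalar_op z) o\<^sub>L (A - scalar_op (cnj z))"
      proof (rule blinfun_eqI)
        fix x
        have "(A - scalar_op z) ((A - scalar_op (cnj z)) x)
            = A (A x) - (cnj z + z) *\<^sub>C A x + (z * cnj z) *\<^sub>C x"
          by (simp add: blinfun.bilinear_simps bounded_opsD[OF selfadj_bounded[OF A]]
              scaleC_diff_right scaleC_scaleC scaleC_add_left)
        also have "cnj z + z = of_real (2 * Re z)" by (simp add: complex_eq_iff)
        also have "z * cnj z = of_real ((Re z)\<^sup>2 + (Im z)\<^sup>2)"
          by (simp add: complex_eq_iff power2_eq_square)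
        finally show "op_poly q A x = ((A - scalar_op z) o\<^sub>L (A - scalar_op (cnj z))) x"
          by (simp only: scaleR_eq_scaleC[symmetric] blinfun_apply_blinfun_compose)
             (simp add: q_def blinfun.bilinear_simps)
      qed
      moreover have "invertible_op \<dots>"
        using False by (intro invertible_op_comp selfadj_nonreal_invertible A) auto
      ultimately show ?thesis
        by (intro split[OF P]) (auto simp: q_def)
    qed
  qed
qed

lemma rspec_op_poly:
  assumes A: "A \<in> bounded_ops" and t: "t \<in> rspec A"
  shows "poly P t \<in> rspec (op_poly P A)"
proof (rule ccontr)
  assume "\<not> ?thesis"
  then have inv: "invertible_op (op_poly (P - [:poly P t:]) A)"
    by (simp add: rspec_iff op_poly_diff)
  have "poly (P - [:poly P t:]) t = 0" by simp
  then obtain R where R: "P - [:poly P t:] = [:- t, 1:] * R" unfolding poly_eq_0_iff_dvd by (rule dvdE)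
  have "invertible_op (op_poly [:- t, 1:] A)"
    by (rule invertible_op_commD(1)[of _ "op_poly R A"])
       (use inv A in \<open>auto simp: R op_poly_mult[symmetric] mult.commute op_poly_bounded simp del: op_poly_pCons mult_pCons_left\<close>)
  with t show False by (simp add: rspec_iff)
qed

lemma rspec_op_polyD:
  fixes A :: "'h::complex_hilbert_space \<Rightarrow>\<^sub>L 'h"
  assumes A: "selfadj A" and nz: "(id_blinfun :: 'h \<Rightarrow>\<^sub>L 'h) \<noteq> 0" and s: "s \<in> rspec (op_poly P A)"
  obtains t where "t \<in> rspec A" "poly P t = s"
proof (cases "P = [:s:]")
  case True
  then show ?thesis using norm_in_rspec[OF A nz] that by auto
next
  case False
  have "\<not> invertible_op (op_poly (P - [:s:]) A)"
    using s by (simp add: rspec_iff op_poly_diff)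
  moreover have "P - [:s:] \<noteq> 0" using False by simp
  ultimately obtain t where "t \<in> rspec A" "poly (P - [:s:]) t = 0"
    using op_poly_invertible[OF A] by blast
  then show ?thesis using that by simp
qed

lemma norm_op_poly_le:
  fixes A :: "'h::complex_hilbert_space \<Rightarrow>\<^sub>L 'h"
  assumes A: "selfadj A" and nz: "(id_blinfun :: 'h \<Rightarrow>\<^sub>L 'h) \<noteq> 0"
    and C: "\<And>t. t \<in> rspec A \<Longrightarrow> \<bar>poly P t\<bar> \<le> C"
  shows "norm (op_poly P A) \<le> C"
proof -
  obtain s where "\<bar>s\<bar> = norm (op_poly P A)" "s \<in> rspec (op_poly P A)"
    using norm_in_rspec[OF selfadj_op_poly[OF A] nz, of P] by (metis abs_minus_cancel abs_norm_cancel)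
  then show ?thesis using rspec_op_polyD[OF A nz] C by metis
qed

lemma abs_poly_le_norm:
  assumes "A \<in> bounded_ops" "t \<in> rspec A"
  shows "\<bar>poly P t\<bar> \<le> norm (op_poly P A)"
  using rspec_abs_le[OF op_poly_bounded rspec_op_poly] assms by blast

subsection \<open>Continuous functional calculus\<close>

definition has_cfc :: "('h::complex_hilbert_space \<Rightarrow>\<^sub>L 'h) \<Rightarrow> (real \<Rightarrow> real) \<Rightarrow> ('h \<Rightarrow>\<^sub>L 'h) \<Rightarrow> bool" where
  "has_cfc A f T \<longleftrightarrow> (\<exists>P. uniform_limit (rspec A) (\<lambda>n. poly (P n)) f sequentially
     \<and> (\<lambda>n. op_poly (P n) A) \<longlonglongrightarrow> T)"

lemma poly_fun_simps:
  "poly (P + Q) = (\<lambda>t. poly P t + poly Q t)"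
  "poly (P * Q) = (\<lambda>t. poly P t * poly Q t)"
  "poly (smult c P) = (\<lambda>t. c * poly P t)" for P :: "real poly"
  by auto

lemma has_cfc_cong:
  assumes "has_cfc A f T" "\<And>t. t \<in> rspec A \<Longrightarrow> f t = g t"
  shows "has_cfc A g T"
proof -
  have "uniform_limit (rspec A) P f F \<longleftrightarrow> uniform_limit (rspec A) P g F" for P :: "nat \<Rightarrow> _" and F
    using assms(2) by (intro uniform_limit_cong') auto
  then show ?thesis using assms(1) unfolding has_cfc_def by blast
qed

lemma has_cfc_poly: "has_cfc A (poly P) (op_poly P A)"
  unfolding has_cfc_def by (rule exI[of _ "\<lambda>_. P"]) (auto simp: uniform_limit_iff)

lemma has_cfc_add:
  assumes "has_cfc A f T" "has_cfc A g S"
  shows "has_cfc A (\<lambda>t. f t + g t) (T + S)"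
proof -
  obtain P Q where P: "uniform_limit (rspec A) (\<lambda>n. poly (P n)) f sequentially" "(\<lambda>n. op_poly (P n) A) \<longlonglongrightarrow> T"
    and Q: "uniform_limit (rspec A) (\<lambda>n. poly (Q n)) g sequentially" "(\<lambda>n. op_poly (Q n) A) \<longlonglongrightarrow> S"
    using assms unfolding has_cfc_def by blast
  show ?thesis unfolding has_cfc_def
    by (rule exI[of _ "\<lambda>n. P n + Q n"])
       (use uniform_limit_add[OF P(1) Q(1)] tendsto_add[OF P(2) Q(2)] in \<open>simp add: op_poly_add poly_fun_simps\<close>)
qed

lemma has_cfc_scaleR:
  assumes "has_cfc A f T"
  shows "has_cfc A (\<lambda>t. c * f t) (c *\<^sub>R T)"
proof -
  obtain P where P: "uniform_limit (rspec A) (\<lambda>n. poly (P n)) f sequentially" "(\<lambda>n. op_poly (P n) A) \<longlonglongrightarrow> T"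
    using assms unfolding has_cfc_def by blast
  show ?thesis unfolding has_cfc_def
    by (rule exI[of _ "\<lambda>n. smult c (P n)"])
       (use bounded_linear.uniform_limit[OF bounded_linear_mult_right P(1)] tendsto_scaleR[OF tendsto_const P(2)]
        in \<open>simp add: op_poly_smult poly_fun_simps\<close>)
qed

lemma has_cfc_diff:
  assumes "has_cfc A f T" "has_cfc A g S"
  shows "has_cfc A (\<lambda>t. f t - g t) (T - S)"
  using has_cfc_add[OF assms(1) has_cfc_scaleR[OF assms(2), of "-1"]] by simp

lemma has_cfc_norm_le:
  fixes A :: "'h::complex_hilbert_space \<Rightarrow>\<^sub>L 'h"
  assumes A: "selfadj A" and nz: "(id_blinfun :: 'h \<Rightarrow>\<^sub>L 'h) \<noteq> 0"
    and T: "has_cfc A f T" and C: "\<And>t. t \<in> rspec A \<Longrightarrow> \<bar>f t\<bar> \<le> C"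
  shows "norm T \<le> C"
proof (rule field_le_epsilon)
  fix e :: real assume e: "e > 0"
  obtain P where P: "uniform_limit (rspec A) (\<lambda>n. poly (P n)) f sequentially" "(\<lambda>n. op_poly (P n) A) \<longlonglongrightarrow> T"
    using T unfolding has_cfc_def by blast
  have "\<forall>\<^sub>F n in sequentially. \<forall>t\<in>rspec A. dist (poly (P n) t) (f t) < e"
    using P(1) e by (rule uniform_limitD)
  then have "\<forall>\<^sub>F n in sequentially. norm (op_poly (P n) A) \<le> C + e"
  proof eventually_elim
    case (elim n)
    show ?case
      by (rule norm_op_poly_le[OF A nz]) (use elim C in \<open>force simp: dist_real_def\<close>)
  qed
  then show "norm T \<le> C + e"
    by (rule tendsto_upperbound[OF tendsto_norm[OF P(2)]]) simp
qed

lemma has_cfc_abs_le: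
  assumes A: "A \<in> bounded_ops" and T: "has_cfc A f T" and t: "t \<in> rspec A"
  shows "\<bar>f t\<bar> \<le> norm T"
proof -
  obtain P where P: "uniform_limit (rspec A) (\<lambda>n. poly (P n)) f sequentially" "(\<lambda>n. op_poly (P n) A) \<longlonglongrightarrow> T"
    using T unfolding has_cfc_def by blast
  have "(\<lambda>n. \<bar>poly (P n) t\<bar>) \<longlonglongrightarrow> \<bar>f t\<bar>"
    by (intro tendsto_rabs tendsto_uniform_limitI[OF P(1)] t)
  then show ?thesis
    by (rule LIMSEQ_le[OF _ tendsto_norm[OF P(2)]]) (use abs_poly_le_norm[OF A t] in blast)
qed

lemma has_cfc_mult:
  assumes A: "A \<in> bounded_ops" and T: "has_cfc A f T" and S: "has_cfc A g S"
  shows "has_cfc A (\<lambda>t. f t * g t) (T o\<^sub>L S)"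
proof -
  obtain P Q where P: "uniform_limit (rspec A) (\<lambda>n. poly (P n)) f sequentially" "(\<lambda>n. op_poly (P n) A) \<longlonglongrightarrow> T"
    and Q: "uniform_limit (rspec A) (\<lambda>n. poly (Q n)) g sequentially" "(\<lambda>n. op_poly (Q n) A) \<longlonglongrightarrow> S"
    using T S unfolding has_cfc_def by blast
  have "bounded (f ` rspec A)" "bounded (g ` rspec A)"
    using has_cfc_abs_le[OF A T] has_cfc_abs_le[OF A S] by (auto simp: bounded_iff)
  then have "uniform_limit (rspec A) (\<lambda>n t. poly (P n) t * poly (Q n) t) (\<lambda>t. f t * g t) sequentially"
    by (intro uniform_lim_mult P(1) Q(1))
  with blinfun_compose.tendsto[OF P(2) Q(2)] show ?thesis unfolding has_cfc_def
    by (intro exI[of _ "\<lambda>n. P n * Q n"]) (simp add: op_poly_mult poly_fun_simps)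
qed

lemma has_cfc_unique:
  fixes A :: "'h::complex_hilbert_space \<Rightarrow>\<^sub>L 'h"
  assumes "selfadj A" "(id_blinfun :: 'h \<Rightarrow>\<^sub>L 'h) \<noteq> 0" "has_cfc A f T" "has_cfc A f S"
  shows "T = S"
  using has_cfc_norm_le[OF assms(1,2) has_cfc_diff[OF assms(3,4)], of 0] by simp

lemma cfc_eqI:
  fixes A :: "'h::complex_hilbert_space \<Rightarrow>\<^sub>L 'h"
  assumes A: "selfadj A" and nz: "(id_blinfun :: 'h \<Rightarrow>\<^sub>L 'h) \<noteq> 0" and T: "has_cfc A f T"
  shows "cfc f A = T"
proof -
  obtain Q where Q: "uniform_limit (rspec A) (\<lambda>n. poly (Q n)) f sequentially" "(\<lambda>n. op_poly (Q n) A) \<longlonglongrightarrow> T"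
    using T unfolding has_cfc_def by blast
  have "(\<lambda>n. op_poly (P n) A) \<longlonglongrightarrow> T"
    if P: "uniform_limit (rspec A) (\<lambda>n. poly (P n)) f sequentially" for P
  proof -
    have "(\<lambda>n. op_poly (P n) A - T) \<longlonglongrightarrow> 0"
    proof (rule tendstoI)
      fix e :: real assume e: "e > 0"
      then have "\<forall>\<^sub>F n in sequentially. \<forall>t\<in>rspec A. dist (poly (P n) t) (f t) < e / 2"
        by (intro uniform_limitD[OF P]) simp
      then show "\<forall>\<^sub>F n in sequentially. dist (op_poly (P n) A - T) 0 < e"
      proof eventually_elim
        case (elim n)
        have "norm (op_poly (P n) A - T) \<le> e / 2"
          by (rule has_cfc_norm_le[OF A nz has_cfc_diff[OF has_cfc_poly T]])
             (use elim in \<open>force simp: dist_real_def\<close>)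
        then show ?case using e by simp
      qed
    qed
    then show ?thesis by (rule Lim_null[THEN iffD2])
  qed
  then show ?thesis unfolding cfc_def rspec_def[symmetric]
    by (intro the_equality) (use Q LIMSEQ_unique in blast)+
qed

lemma has_cfc_cfc:
  fixes A :: "'h::complex_hilbert_space \<Rightarrow>\<^sub>L 'h"
  assumes A: "selfadj A" and nz: "(id_blinfun :: 'h \<Rightarrow>\<^sub>L 'h) \<noteq> 0"
    and sub: "rspec A \<subseteq> {a..b}" and f: "continuous_on {a..b} f"
  shows "has_cfc A f (cfc f A)"
proof -
  have "\<exists>P. \<forall>t\<in>{a..b}. \<bar>f t - poly P t\<bar> < inverse (real (Suc n))" for n
  proof -
    obtain g where g: "real_polynomial_function g" "\<And>t. t \<in> {a..b} \<Longrightarrow> \<bar>f t - g t\<bar> < inverse (real (Suc n))"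
      using Stone_Weierstrass_real_polynomial_function[OF compact_Icc f, of "inverse (real (Suc n))"]
      by auto
    then obtain c m where "g = (\<lambda>x. \<Sum>i\<le>m. c i * x ^ i)"
      by (auto simp: real_polynomial_function_iff_sum)
    then have "g = poly (\<Sum>i\<le>m. monom (c i) i)" by (auto simp: poly_sum poly_monom)
    with g show ?thesis by blast
  qed
  then obtain P where P: "\<And>n t. t \<in> {a..b} \<Longrightarrow> \<bar>f t - poly (P n) t\<bar> < inverse (real (Suc n))" by metis
  have small: "\<exists>N. \<forall>n\<ge>N. \<forall>t\<in>rspec A. \<bar>f t - poly (P n) t\<bar> < e" if "e > 0" for e
  proof -
    obtain N where N: "inverse (real (Suc N)) < e" using reals_Archimedean \<open>e > 0\<close> by auto
    have "\<bar>f t - poly (P n) t\<bar> < e" if "n \<ge> N" "t \<in> rspec A" for n t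
    proof -
      have "inverse (real (Suc n)) \<le> inverse (real (Suc N))" using that by (intro le_imp_inverse_le) auto
      moreover have "t \<in> {a..b}" using that(2) sub by blast
      ultimately show ?thesis using P[of t n] N by linarith
    qed
    then show ?thesis by blast
  qed
  have ul: "uniform_limit (rspec A) (\<lambda>n. poly (P n)) f sequentially"
    unfolding uniform_limit_sequentially_iff using small
    by (simp add: dist_real_def abs_minus_commute)
  have "Cauchy (\<lambda>n. op_poly (P n) A)"
  proof (rule CauchyI)
    fix e :: real assume e: "e > 0"
    then obtain N where N: "\<forall>n\<ge>N. \<forall>t\<in>rspec A. \<bar>f t - poly (P n) t\<bar> < e / 4"
      using small[of "e / 4"] by auto
    have "norm (op_poly (P m) A - op_poly (P n) A) < e" if "m \<ge> N" "n \<ge> N" for m n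
    proof -
      have "norm (op_poly (P m - P n) A) \<le> e / 2"
      proof (rule norm_op_poly_le[OF A nz])
        fix t assume "t \<in> rspec A"
        then have "\<bar>f t - poly (P m) t\<bar> < e / 4" "\<bar>f t - poly (P n) t\<bar> < e / 4" using N that by auto
        then show "\<bar>poly (P m - P n) t\<bar> \<le> e / 2" unfolding poly_diff by linarith
      qed
      then show ?thesis using e by (simp add: op_poly_diff)
    qed
    then show "\<exists>M. \<forall>m\<ge>M. \<forall>n\<ge>M. norm (op_poly (P m) A - op_poly (P n) A) < e" by blast
  qed
  then obtain T where "(\<lambda>n. op_poly (P n) A) \<longlonglongrightarrow> T"
    using Cauchy_convergent_iff convergent_def by blast
  then have "has_cfc A f T" using ul unfolding has_cfc_def by blast
  then show ?thesis using cfc_eqI[OF A nz] by simp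
qed

lemma has_cfc_commutant:
  assumes "has_cfc A f T" "A \<in> commutant M" shows "T \<in> commutant M"
proof -
  obtain P where P: "(\<lambda>n. op_poly (P n) A) \<longlonglongrightarrow> T" using assms(1) unfolding has_cfc_def by blast
  show ?thesis
    by (rule closed_sequentially[OF commutant_closed _ P]) (rule op_poly_commutant[OF assms(2)])
qed

lemma has_cfc_selfadj:
  assumes A: "selfadj A" and T: "has_cfc A f T" shows "selfadj T"
proof -
  obtain P where P: "(\<lambda>n. op_poly (P n) A) \<longlonglongrightarrow> T" using T unfolding has_cfc_def by blast
  have "T \<in> bounded_ops"
    using has_cfc_commutant[OF T, of "{}"] A by (simp add: commutant_empty selfadj_bounded)
  moreover have "cinner (T x) y = cinner x (T y)" for x y
  proof (rule LIMSEQ_unique)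
    show "(\<lambda>n. cinner (op_poly (P n) A x) y) \<longlonglongrightarrow> cinner (T x) y"
      by (intro tendsto_cinner blinfun.tendsto P tendsto_const)
    show "(\<lambda>n. cinner (op_poly (P n) A x) y) \<longlonglongrightarrow> cinner x (T y)"
      unfolding selfadj_cinner[OF selfadj_op_poly[OF A]]
      by (intro tendsto_cinner blinfun.tendsto P tendsto_const)
  qed
  ultimately show ?thesis by (simp add: selfadj_def)
qed

lemma has_cfc_op_poly:
  assumes A: "A \<in> bounded_ops" and T: "has_cfc A f T"
  shows "has_cfc A (\<lambda>t. poly P (f t)) (op_poly P T)"
proof (induction P)
  case 0
  show ?case using has_cfc_cong[OF has_cfc_poly[of A 0]] by auto
next
  case (pCons a P)
  show ?case
    using has_cfc_add[OF has_cfc_poly[of A "[:a:]"] has_cfc_mult[OF A T pCons(2)]] by simp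
qed

lemma has_cfc_compose:
  fixes A :: "'h::complex_hilbert_space \<Rightarrow>\<^sub>L 'h"
  assumes A: "selfadj A" and nz: "(id_blinfun :: 'h \<Rightarrow>\<^sub>L 'h) \<noteq> 0"
    and sub: "rspec A \<subseteq> {c..d}" and f: "continuous_on {c..d} f" and T: "has_cfc A f T"
    and im: "f ` {c..d} \<subseteq> {a..b}" and rT: "rspec T \<subseteq> {a..b}" and g: "continuous_on {a..b} g"
  shows "has_cfc A (\<lambda>t. g (f t)) (cfc g T)"
proof -
  have "continuous_on {c..d} (\<lambda>t. g (f t))" by (rule continuous_on_compose2[OF g f im])
  then have S: "has_cfc A (\<lambda>t. g (f t)) (cfc (\<lambda>t. g (f t)) A)" (is "has_cfc A _ ?S")
    by (rule has_cfc_cfc[OF A nz sub])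
  obtain p where p: "uniform_limit {a..b} p g sequentially" "\<And>n. polynomial_function (p n)"
    using Stone_Weierstrass_uniform_limit[OF compact_Icc g] by blast
  have "\<exists>P. p n = poly P" for n
  proof -
    obtain c m where "p n = (\<lambda>x. \<Sum>i\<le>m. c i * x ^ i)"
      using p(2)[of n] by (auto simp: real_polynomial_function_eq[symmetric] real_polynomial_function_iff_sum)
    then have "p n = poly (\<Sum>i\<le>m. monom (c i) i)" by (auto simp: poly_sum poly_monom)
    then show ?thesis by blast
  qed
  then obtain P where "\<And>n. p n = poly (P n)" by metis
  then have P: "uniform_limit {a..b} (\<lambda>n. poly (P n)) g sequentially" using p(1) by presburger
  have "(\<lambda>n. op_poly (P n) T - ?S) \<longlonglongrightarrow> 0"
  proof (rule tendstoI)
    fix e :: real assume e: "e > 0"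
    then have "\<forall>\<^sub>F n in sequentially. \<forall>t\<in>{a..b}. dist (poly (P n) t) (g t) < e / 2"
      by (intro uniform_limitD[OF P]) simp
    then show "\<forall>\<^sub>F n in sequentially. dist (op_poly (P n) T - ?S) 0 < e"
    proof eventually_elim
      case (elim n)
      have "norm (op_poly (P n) T - ?S) \<le> e / 2"
      proof (rule has_cfc_norm_le[OF A nz has_cfc_diff[OF has_cfc_op_poly[OF selfadj_bounded[OF A] T] S]])
        fix t assume "t \<in> rspec A"
        then have "f t \<in> {a..b}" using sub im by blast
        then show "\<bar>poly (P n) (f t) - g (f t)\<bar> \<le> e / 2" using elim by (force simp: dist_real_def)
      qed
      then show ?case using e by simp
    qed
  qed
  then have "(\<lambda>n. op_poly (P n) T) \<longlonglongrightarrow> ?S" by (rule Lim_null[THEN iffD2])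
  moreover have "uniform_limit (rspec T) (\<lambda>n. poly (P n)) g sequentially"
    using P rT by (rule uniform_limit_on_subset)
  ultimately have "has_cfc T g ?S" unfolding has_cfc_def by blast
  then show ?thesis using S cfc_eqI[OF has_cfc_selfadj[OF A T] nz] by simp
qed

lemma rspec_subset_nonneg:
  assumes A: "selfadj A" and nz: "(id_blinfun :: 'h::complex_hilbert_space \<Rightarrow>\<^sub>L 'h) \<noteq> 0"
    and sub: "rspec (A :: 'h \<Rightarrow>\<^sub>L 'h) \<subseteq> {c..d}" and f: "continuous_on {c..d} f" and T: "has_cfc A f T"
    and im: "f ` {c..d} \<subseteq> {0..b}"
  shows "rspec T \<subseteq> {0..b}"
proof
  fix t assume t: "t \<in> rspec T"
  note sT = has_cfc_selfadj[OF A T]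
  have H: "has_cfc A (\<lambda>t. sqrt (f t)) (cfc (\<lambda>t. sqrt (f t)) A)" (is "has_cfc A _ ?H")
    by (intro has_cfc_cfc[OF A nz sub] continuous_intros f)
  have "has_cfc A f (?H o\<^sub>L ?H)"
    by (rule has_cfc_cong[OF has_cfc_mult[OF selfadj_bounded[OF A] H H]]) (use sub im in force)
  then have TH: "T = ?H o\<^sub>L ?H" by (rule has_cfc_unique[OF A nz T])
  have "cinner x (T x) = (norm (?H x))\<^sup>2" for x
    by (simp add: TH selfadj_cinner[OF has_cfc_selfadj[OF A H], symmetric] cinner_self)
  then have "0 \<le> t" by (intro rspec_nonneg[OF selfadj_bounded[OF sT] _ t]) simp
  moreover have "norm T \<le> b"
    by (rule has_cfc_norm_le[OF A nz T]) (use sub im in force)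
  ultimately show "t \<in> {0..b}" using rspec_abs_le[OF selfadj_bounded[OF sT] t] by simp
qed

subsection \<open>The trace identity\<close>

lemma continuous_on_powr_const:
  fixes f :: "real \<Rightarrow> real"
  assumes "q > 0" "continuous_on S f" "\<And>t. t \<in> S \<Longrightarrow> 0 \<le> f t"
  shows "continuous_on S (\<lambda>t. f t powr q)"
  using assms by (intro continuous_on_powr') auto

definition powr_gap :: "real \<Rightarrow> real \<Rightarrow> real" where
  "powr_gap q t = t powr q + (4 - t) powr q - 4 powr q"

lemma powr_gap_zero_iff:
  assumes "q > 0" "q \<noteq> 1" "t \<in> {0..4}"
  shows "powr_gap q t = 0 \<longleftrightarrow> t * (4 - t) = 0"
    and powr_gap_sgn: "powr_gap q t = (if q < 1 then 1 else -1) * \<bar>powr_gap q t\<bar>"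
proof -
  have split: "s powr q = s * s powr (q - 1)" if "s > 0" for s :: real
    using that powr_add[of s 1 "q - 1"] by simp
  have eq: "powr_gap q t = t * (t powr (q-1) - 4 powr (q-1)) + (4 - t) * ((4 - t) powr (q-1) - 4 powr (q-1))"
    if "0 < t" "t < 4"
    using split[of t] split[of "4 - t"] split[of 4] that by (simp add: powr_gap_def algebra_simps)
  have "powr_gap q t = 0" if "t = 0 \<or> t = 4"
    using that by (auto simp: powr_gap_def)
  moreover have "powr_gap q t > 0" if "0 < t" "t < 4" "q < 1"
    unfolding eq[OF that(1,2)]
    using that by (intro add_pos_pos mult_pos_pos) (auto intro!: powr_less_mono2_neg)
  moreover have "powr_gap q t < 0" if "0 < t" "t < 4" "q > 1"
    unfolding eq[OF that(1,2)]
    using that by (intro add_neg_neg mult_pos_neg) (auto intro!: powr_less_mono2)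
  ultimately show "powr_gap q t = 0 \<longleftrightarrow> t * (4 - t) = 0"
    "powr_gap q t = (if q < 1 then 1 else -1) * \<bar>powr_gap q t\<bar>"
    using assms less_linear[of q 1] by (auto simp: order_le_less)
qed

lemma has_cfc_op_powr_sqrt:
  fixes B :: "'h::complex_hilbert_space \<Rightarrow>\<^sub>L 'h"
  assumes B: "selfadj B" and nz: "(id_blinfun :: 'h \<Rightarrow>\<^sub>L 'h) \<noteq> 0"
    and sub: "rspec B \<subseteq> {0..b}" and p: "p > 0"
  shows "has_cfc B (\<lambda>t. t powr (p / 2)) (op_powr (cfc sqrt B) p)"
proof -
  have c: "continuous_on {0..b} sqrt" by (intro continuous_intros)
  have im: "sqrt ` {0..b} \<subseteq> {0..sqrt b}" by auto
  have g: "continuous_on {0..sqrt b} (\<lambda>t. t powr p)"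
    by (rule continuous_on_powr_const[OF p continuous_on_id]) simp
  note T = has_cfc_cfc[OF B nz sub c]
  have "has_cfc B (\<lambda>t. sqrt t powr p) (op_powr (cfc sqrt B) p)"
    unfolding op_powr_def
    by (rule has_cfc_compose[OF B nz sub c T im rspec_subset_nonneg[OF B nz sub c T im] g])
  then show ?thesis
  proof (rule has_cfc_cong)
    fix t assume "t \<in> rspec B"
    then have "0 \<le> t" using sub by auto
    then show "sqrt t powr p = t powr (p / 2)"
      by (simp add: powr_half_sqrt[symmetric] powr_powr)
  qed
qed

lemma trace_scaleR:
  assumes "tracial_state N \<tau>" "A \<in> N"
  shows "\<tau> (r *\<^sub>R A) = of_real r * \<tau> A"
proof -
  have "scalar_op (of_real r) o\<^sub>L A = r *\<^sub>R A"
    by (rule blinfun_eqI) (simp add: scaleR_eq_scaleC blinfun.bilinear_simps)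
  then show ?thesis using assms unfolding tracial_state_def by metis
qed

lemma trace_cfc_nonneg:
  fixes B :: "'h::complex_hilbert_space \<Rightarrow>\<^sub>L 'h"
  assumes B: "selfadj B" and nz: "(id_blinfun :: 'h \<Rightarrow>\<^sub>L 'h) \<noteq> 0"
    and sub: "rspec B \<subseteq> {a..b}" and f: "continuous_on {a..b} f" "\<And>t. t \<in> {a..b} \<Longrightarrow> 0 \<le> f t"
    and X: "has_cfc B f X"
    and N: "von_neumann_algebra N" "B \<in> N" and \<tau>: "tracial_state N \<tau>"
  shows "X \<in> N" "\<tau> X \<in> \<real>\<^sub>\<ge>\<^sub>0" "faithful_on N \<tau> \<Longrightarrow> \<tau> X = 0 \<longleftrightarrow> X = 0"
proof -
  have comm: "commutant (commutant N) = N" using N by (simp add: von_neumann_algebra_def)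
  show "X \<in> N" using has_cfc_commutant[OF X, of "commutant N"] N comm by simp
  have H: "has_cfc B (\<lambda>t. sqrt (f t)) (cfc (\<lambda>t. sqrt (f t)) B)" (is "has_cfc B _ ?H")
    by (intro has_cfc_cfc[OF B nz sub] continuous_intros f)
  have HN: "?H \<in> N" using has_cfc_commutant[OF H, of "commutant N"] N comm by simp
  have "has_cfc B f (?H o\<^sub>L ?H)"
    by (rule has_cfc_cong[OF has_cfc_mult[OF selfadj_bounded[OF B] H H]]) (use sub f in force)
  then have "X = ?H o\<^sub>L ?H" by (rule has_cfc_unique[OF B nz X])
  moreover have "adj ?H = ?H"
    using has_cfc_selfadj[OF B H] by (intro adj_eqI) (auto simp: selfadj_def)
  ultimately have XH: "X = adj ?H o\<^sub>L ?H" by simp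
  show "\<tau> X \<in> \<real>\<^sub>\<ge>\<^sub>0" unfolding XH using \<tau> HN by (simp add: tracial_state_def)
  have "\<tau> 0 = 0" using trace_scaleR[OF \<tau> HN, of 0] by simp
  then show "\<tau> X = 0 \<longleftrightarrow> X = 0" if "faithful_on N \<tau>"
    using that HN unfolding faithful_on_def by (metis XH blinfun_compose_zero(2))
qed

lemma trace_norm_powr:
  assumes "p > 0" "0 \<le> Re (\<tau> (op_powr (op_abs A) p))"
  shows "trace_norm \<tau> p A powr p = Re (\<tau> (op_powr (op_abs A) p))"
  using assms by (simp add: trace_norm_def powr_powr)

theorem lemma2p2:
  fixes N :: "('h::complex_hilbert_space \<Rightarrow>\<^sub>L 'h) set"
    and \<tau> :: "('h \<Rightarrow>\<^sub>L 'h) \<Rightarrow> complex"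
    and U :: "'h \<Rightarrow>\<^sub>L 'h"
    and p :: real
  assumes "0 < p" and "p \<noteq> 2"
    and "finite_factor N"
    and "faithful_normal_tracial_state N \<tau>"
    and "U \<in> unitary_group N"
  shows "trace_norm \<tau> p (id_blinfun - U) powr p + trace_norm \<tau> p (id_blinfun + U) powr p = 2 powr p
         \<longleftrightarrow> U = adj U"
proof -
  have vN: "von_neumann_algebra N" using assms(3) by (simp add: finite_factor_def factor_def)
  have \<tau>: "tracial_state N \<tau>" and faith: "faithful_on N \<tau>"
    using assms(4) by (auto simp: faithful_normal_tracial_state_def)
  have comm: "commutant (commutant N) = N" using vN by (simp add: von_neumann_algebra_def)
  note N_intros = commutant_intros[where M = "commutant N", unfolded comm]
    commutant_comp[where M = "commutant N", unfolded comm]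
  define I where "I = (id_blinfun :: 'h \<Rightarrow>\<^sub>L 'h)"
  have IN: "I \<in> N" using commutant_id[of "commutant N"] by (simp add: comm I_def)
  have \<tau>I: "\<tau> I = 1" using \<tau> by (simp add: tracial_state_def I_def)
  have nz: "(id_blinfun :: 'h \<Rightarrow>\<^sub>L 'h) \<noteq> 0"
    using \<tau>I trace_scaleR[OF \<tau> IN, of 0] by (auto simp: I_def)
  define V where "V = adj U"
  have U: "U \<in> N" "U \<in> bounded_ops" and V: "V \<in> N" "V \<in> bounded_ops"
    using assms(5) vN by (auto simp: unitary_group_def von_neumann_algebra_def V_def)
  have UV: "U (V x) = x" "V (U x) = x" for x
    using assms(5) by (auto simp: unitary_group_def V_def blinfun_eq_iff)
  have adj_UV: "cinner (U x) y = cinner x (V y)" "cinner (V x) y = cinner x (U y)" for x y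
    using U by (simp_all add: V_def cinner_adj_left cinner_adj_right)
  have adj_minus: "adj (I - U) = I - V"
    by (rule adj_eqI) (use U in \<open>simp_all add: I_def bounded_ops_intros blinfun.bilinear_simps cinner_simps adj_UV\<close>)
  have adj_plus: "adj (I + U) = I + V"
    by (rule adj_eqI) (use U in \<open>simp_all add: I_def bounded_ops_intros blinfun.bilinear_simps cinner_simps adj_UV\<close>)
  have adj_UV_diff: "adj (U - V) = V - U"
    by (rule adj_eqI) (use U V in \<open>simp_all add: bounded_ops_intros blinfun.bilinear_simps cinner_simps adj_UV\<close>)
  define B where "B = adj (I - U) o\<^sub>L (I - U)"
  define B' where "B' = adj (I + U) o\<^sub>L (I + U)"
  have Bx: "B x = 2 *\<^sub>R x - U x - V x" and B'x: "B' x = 2 *\<^sub>R x + U x + V x" for x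
    unfolding B_def B'_def adj_minus adj_plus
    by (simp_all add: I_def blinfun.bilinear_simps UV scaleR_2)
  have B'_poly: "B' = op_poly [:4, -1:] B"
    by (rule blinfun_eqI) (simp add: Bx B'x blinfun.bilinear_simps algebra_simps flip: scaleR_left.add)
  have B_poly: "B = op_poly [:4, -1:] B'"
    by (rule blinfun_eqI) (simp add: Bx B'x blinfun.bilinear_simps algebra_simps flip: scaleR_left.add)
  have BN: "B \<in> N" unfolding B_def adj_minus by (intro N_intros IN U V)
  have B'N: "B' \<in> N" unfolding B'_def adj_plus by (intro N_intros IN U V)
  have saB: "selfadj B" and saB': "selfadj B'"
    using BN B'N vN by (auto simp: selfadj_def von_neumann_algebra_def Bx B'x cinner_simps adj_UV)
  have "0 \<le> Re (cinner x (B x))" for x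
    by (simp add: B_def cinner_adj_right I_def U bounded_ops_intros Re_cinner_self)
  then have nonneg: "t \<ge> 0" if "t \<in> rspec B" for t
    by (rule rspec_nonneg[OF selfadj_bounded[OF saB] _ that])
  have "0 \<le> Re (cinner x (B' x))" for x
    by (simp add: B'_def cinner_adj_right I_def U bounded_ops_intros Re_cinner_self)
  then have nonneg': "t \<ge> 0" if "t \<in> rspec B'" for t
    by (rule rspec_nonneg[OF selfadj_bounded[OF saB'] _ that])
  have sub: "rspec B \<subseteq> {0..4}"
    using rspec_op_poly[OF selfadj_bounded[OF saB], of _ "[:4, -1:]"] nonneg nonneg'
    by (fastforce simp: B'_poly[symmetric] simp del: op_poly_pCons)
  have sub': "rspec B' \<subseteq> {0..4}"
    using rspec_op_poly[OF selfadj_bounded[OF saB'], of _ "[:4, -1:]"] nonneg nonneg'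
    by (fastforce simp: B_poly[symmetric] simp del: op_poly_pCons)

  define q where "q = p / 2"
  have q: "q > 0" "q \<noteq> 1" using assms by (auto simp: q_def)
  define X where "X = op_powr (op_abs (I - U)) p"
  define X' where "X' = op_powr (op_abs (I + U)) p"
  have X: "has_cfc B (\<lambda>t. t powr q) X"
    unfolding X_def op_abs_def q_def B_def[symmetric]
    by (rule has_cfc_op_powr_sqrt[OF saB nz sub assms(1)])
  have X': "has_cfc B' (\<lambda>t. t powr q) X'"
    unfolding X'_def op_abs_def q_def B'_def[symmetric]
    by (rule has_cfc_op_powr_sqrt[OF saB' nz sub' assms(1)])
  have cont: "continuous_on {0..4} (\<lambda>t. t powr q)"
    using q by (intro continuous_on_powr_const continuous_intros) auto
  have cont': "continuous_on {0..4} (\<lambda>t. (4 - t) powr q)"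
    using q by (intro continuous_on_powr_const continuous_intros) auto
  have lin: "has_cfc B (poly [:4, -1:]) B'"
    unfolding B'_poly by (rule has_cfc_poly)
  have "has_cfc B (\<lambda>t. poly [:4, -1:] t powr q) (cfc (\<lambda>t. t powr q) B')"
    by (rule has_cfc_compose[OF saB nz sub _ lin _ sub' cont]) (auto intro!: continuous_intros)
  then have X'B: "has_cfc B (\<lambda>t. (4 - t) powr q) X'"
    by (simp add: cfc_eqI[OF saB' nz X'])
  note trX = trace_cfc_nonneg[OF saB nz sub cont powr_ge_zero X vN BN \<tau>]
  note trX' = trace_cfc_nonneg[OF saB nz sub cont' powr_ge_zero X'B vN BN \<tau>]

  define \<sigma> where "\<sigma> = (if q < 1 then 1 else - 1 :: real)"
  have "continuous_on {0..4} (powr_gap q)"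
    unfolding powr_gap_def by (intro continuous_intros cont cont')
  then have contg: "continuous_on {0..4} (\<lambda>t. \<bar>powr_gap q t\<bar>)" by (intro continuous_intros)
  define G where "G = cfc (\<lambda>t. \<bar>powr_gap q t\<bar>) B"
  have G: "has_cfc B (\<lambda>t. \<bar>powr_gap q t\<bar>) G"
    unfolding G_def by (rule has_cfc_cfc[OF saB nz sub contg])
  note trG = trace_cfc_nonneg[OF saB nz sub contg abs_ge_zero G vN BN \<tau>]
  have "has_cfc B (\<lambda>t. \<sigma> * \<bar>powr_gap q t\<bar>) (X + X' - op_poly [:4 powr q:] B)"
  proof (rule has_cfc_cong[OF has_cfc_diff[OF has_cfc_add[OF X X'B] has_cfc_poly[of B "[:4 powr q:]"]]])
    fix t assume "t \<in> rspec B"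
    then have "t \<in> {0..4}" using sub by blast
    from powr_gap_sgn[OF q this] show "t powr q + (4 - t) powr q - poly [:4 powr q:] t = \<sigma> * \<bar>powr_gap q t\<bar>"
      by (simp add: powr_gap_def \<sigma>_def)
  qed
  then have "X + X' - op_poly [:4 powr q:] B = \<sigma> *\<^sub>R G"
    by (rule has_cfc_unique[OF saB nz]) (rule has_cfc_scaleR[OF G])
  then have "X + X' = (4 powr q) *\<^sub>R I + \<sigma> *\<^sub>R G"
    by (simp add: I_def algebra_simps)
  moreover have "\<tau> (X + X') = \<tau> X + \<tau> X'"
    using \<tau> trX(1) trX'(1) by (simp add: tracial_state_def)
  moreover have "\<tau> ((4 powr q) *\<^sub>R I + \<sigma> *\<^sub>R G) = of_real (4 powr q) + of_real \<sigma> * \<tau> G"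
  proof -
    have "(4 powr q) *\<^sub>R I \<in> N" "\<sigma> *\<^sub>R G \<in> N" by (intro N_intros IN trG)+
    then show ?thesis using \<tau> trace_scaleR[OF \<tau> IN] trace_scaleR[OF \<tau> trG(1)] \<tau>I
      by (simp add: tracial_state_def)
  qed
  ultimately have "\<tau> X + \<tau> X' = of_real (4 powr q) + of_real \<sigma> * \<tau> G" by metis
  from arg_cong[OF this, of Re] have tr: "Re (\<tau> X) + Re (\<tau> X') = 4 powr q + \<sigma> * Re (\<tau> G)"
    by simp
  have tn: "trace_norm \<tau> p (I - U) powr p = Re (\<tau> X)" "trace_norm \<tau> p (I + U) powr p = Re (\<tau> X')"
    using trX(2) trX'(2) assms(1)
    by (auto simp: X_def X'_def complex_nonneg_Reals_iff intro!: trace_norm_powr)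
  have two: "2 powr p = 4 powr q"
    using powr_powr[of 2 2 q] by (simp add: q_def)
  have "trace_norm \<tau> p (I - U) powr p + trace_norm \<tau> p (I + U) powr p = 2 powr p \<longleftrightarrow> Re (\<tau> G) = 0"
    by (simp add: tn tr two \<sigma>_def)
  also have "\<dots> \<longleftrightarrow> G = 0"
    using trG(2) trG(3)[OF faith] by (auto simp: complex_nonneg_Reals_iff complex_eq_iff)
  also have "\<dots> \<longleftrightarrow> (\<forall>t\<in>rspec B. powr_gap q t = 0)"
    using has_cfc_abs_le[OF selfadj_bounded[OF saB] G] has_cfc_norm_le[OF saB nz G, of 0] by force
  also have "\<dots> \<longleftrightarrow> (\<forall>t\<in>rspec B. poly [:0, 4, -1:] t = 0)"
    using powr_gap_zero_iff[OF q] sub by (intro ball_cong) (auto simp: algebra_simps)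
  also have "\<dots> \<longleftrightarrow> op_poly [:0, 4, -1:] B = 0"
    using abs_poly_le_norm[OF selfadj_bounded[OF saB], of _ "[:0, 4, -1:]"]
      norm_op_poly_le[OF saB nz, of "[:0, 4, -1:]" 0] by force
  also have "op_poly [:0, 4, -1:] B = adj (U - V) o\<^sub>L (U - V)"
  proof (rule blinfun_eqI)
    have s4: "4 *\<^sub>R y = y + y + y + y" for y :: 'h
      using scaleR_add_left[of 2 2 y] by (simp add: scaleR_2 add.assoc)
    have s8: "8 *\<^sub>R y = y + y + y + y + y + y + y + y" for y :: 'h
      using scaleR_add_left[of 4 4 y] by (simp add: s4 add.assoc)
    show "op_poly [:0, 4, -1:] B x = (adj (U - V) o\<^sub>L (U - V)) x" for x
      by (simp add: adj_UV_diff Bx blinfun.bilinear_simps UV algebra_simps scaleR_2 s4 s8)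
  qed
  also have "\<dots> = 0 \<longleftrightarrow> U - V = 0"
    by (intro adj_comp_eq_zero_iff bounded_ops_intros U V)
  finally show ?thesis by (simp add: I_def V_def)
qed

end
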